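(* Let $\mathsf{T}$ be of $\mathsf{ADE}$ type, i.e. $\mathsf{T}$ is one of $\mathsf{A}_{h-1}$ ($h\ge 2$), $\mathsf{D}_{\frac h2+1}$ ($h\ge 6$ even), $\mathsf{E}_6$ ($h=12$), $\mathsf{E}_7$ ($h=18$), $\mathsf{E}_8$ ($h=30$), and let $(h,d_1,d_2,d_3)$ and the integers $\mathscr{N}_{\ell,\ell'}$ ($1\le \ell,\ell'\le h-1$) be the data attached to $\mathsf{T}$ in the two tables of the context. Then, for every complex $q$ with $0<|q|<1$, as an identity of meromorphic functions of $x\in\mathbb{C}^\times$, $$\prod_{i=1}^{3}\frac{\theta(x^{h-d_i},q)}{\theta(x^{d_i},q)}=\sum_{\ell,\ell'=1}^{h-1}\mathscr{N}_{\ell,\ell'}\,\mathbb{J}^{\ell}_{\ell'}(x,q),$$ where $$\mathbb{J}^{\ell}_{\ell'}(x,q)=q^{\frac{\ell^2-\ell'^2}{4h}}\,x^{\ell'-1}\,\frac{\theta(x^h,q)\,\theta(q^{\ell},q^h)}{\theta(q^{\frac{\ell+\ell'}{2}}x^{-h},q^h)\,\theta(q^{\frac{\ell-\ell'}{2}}x^h,q^h)}.$$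
   Context: For $|q|<1$ set $(x;q)_\infty=\prod_{n=0}^\infty(1-xq^n)$, $(q)_\infty=(q;q)_\infty$, and for $x\neq 0$ (and $0<|q|<1$) set $$\theta(x,q)=\frac{(x;q)_\infty (q/x;q)_\infty}{(q)_\infty^2}.$$ Table of $(h,d_1,d_2,d_3)$: - $\mathsf{A}_{h-1}$ ($h\ge2$): $(h,1,\tfrac h2,\tfrac h2)$. (The factors with $d_i=h/2$ are of the form $\theta(x^{h/2},q)/\theta(x^{h/2},q)$ and are read as $1$, also when $h$ is odd.) - $\mathsf{D}_{\frac h2+1}$ ($h\ge 6$ even): $(h,2,\tfrac h2-1,\tfrac h2)$. - $\mathsf{E}_6$: $(12,3,4,6)$. - $\mathsf{E}_7$: $(18,4,6,9)$. - $\mathsf{E}_8$: $(30,6,10,15)$. Table of $\mathscr{N}_{\ell,\ell'}$: the integers $\mathscr{N}_{\ell,\ell'}$, $1\le\ell,\ell'\le h-1$, are the coefficients of $\chi_\ell\overline{\chi_{\ell'}}$ in the following sesquilinear expressions in formal symbols $\chi_1,\dots,\chi_{h-1}$ (where $|a|^2=a\bar a$), written as $\sum_{\ell,\ell'}\mathscr{N}_{\ell,\ell'}\chi_\ell\overline{\chi_{\ell'}}$: - $\mathsf{A}_{h-1}$: $\sum_{\ell=1}^{h-1}|\chi_\ell|^2$. - $\mathsf{D}_{\frac h2+1}$ with $h/2$ odd: $\sum_{i=1}^{(h-2)/4}|\chi_{2i-1}+\chi_{h-(2i-1)}|^2+2|\chi_{h/2}|^2$. - $\mathsf{D}_{\frac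 h2+1}$ with $h/2$ even: $\sum_{i=1}^{h/2}|\chi_{2i-1}|^2+|\chi_{h/2}|^2+\sum_{i=1}^{h/4-1}(\chi_{2i}\overline{\chi_{h-2i}}+\chi_{h-2i}\overline{\chi_{2i}})$. - $\mathsf{E}_6$: $|\chi_1+\chi_7|^2+|\chi_4+\chi_8|^2+|\chi_5+\chi_{11}|^2$. - $\mathsf{E}_7$: $|\chi_1+\chi_{17}|^2+|\chi_5+\chi_{13}|^2+|\chi_7+\chi_{11}|^2+|\chi_9|^2+(\chi_3+\chi_{15})\overline{\chi_9}+\chi_9\overline{(\chi_3+\chi_{15})}$. - $\mathsf{E}_8$: $|\chi_1+\chi_{11}+\chi_{19}+\chi_{29}|^2+|\chi_7+\chi_{13}+\chi_{17}+\chi_{23}|^2$. Whenever $\mathscr{N}_{\ell,\ell'}\neq0$ one has $\ell\equiv\ell' \pmod 2$ and $4h\mid \ell^2-\ell'^2$, so all powers of $q$ in the corresponding term are integral; terms with $\mathscr{N}_{\ell,\ell'}=0$ are omitted from the sum. *)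

theory Defs
  imports "HOL-Complex_Analysis.Complex_Analysis"
begin

definition qpoch_inf :: "complex \<Rightarrow> complex \<Rightarrow> complex" where
  "qpoch_inf x q = (\<Prod>n. 1 - x * q ^ n)"

definition theta :: "complex \<Rightarrow> complex \<Rightarrow> complex" where
  "theta x q = qpoch_inf x q * qpoch_inf (q / x) q / (qpoch_inf q q)\<^sup>2"

text \<open>
  Identity of meromorphic functions: equality may fail on a subset of \<open>A\<close> that has no
  accumulation point in \<open>A\<close>, because at poles (and wherever a denominator of a defining
  expression vanishes) the values of the HOL functions are junk values.
\<close>

definition mero_eq_on :: "complex set \<Rightarrow> (complex \<Rightarrow> complex) \<Rightarrow> (complex \<Rightarrow> complex) \<Rightarrow> bool" where
  "mero_eq_on A f g \<longleftrightarrow>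
     f meromorphic_on A \<and> g meromorphic_on A \<and> (\<forall>\<^sub>\<approx>x\<in>A. f x = g x)"


text \<open>
  The types \<open>A\<^sub>n\<close> and \<open>D\<^sub>n\<close> are indexed by their rank \<open>n\<close>. In terms of the Coxeter number \<open>h\<close>,
  the rank is \<open>h - 1\<close> for type A and \<open>h/2 + 1\<close> for type D, so that the constraints of
  \<open>is_ade\<close> are \<open>h \<ge> 2\<close> for type A and \<open>h \<ge> 6\<close>, \<open>h\<close> even, for type D.
\<close>

datatype ade = TypeA nat | TypeD nat | TypeE6 | TypeE7 | TypeE8

fun is_ade :: "ade \<Rightarrow> bool" where
  "is_ade (TypeA n) = (n \<ge> 1)"
| "is_ade (TypeD n) = (n \<ge> 4)"
| "is_ade TypeE6 = True"
| "is_ade TypeE7 = True"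
| "is_ade TypeE8 = True"

fun coxeter :: "ade \<Rightarrow> nat" where
  "coxeter (TypeA n) = n + 1"
| "coxeter (TypeD n) = 2 * (n - 1)"
| "coxeter TypeE6 = 12"
| "coxeter TypeE7 = 18"
| "coxeter TypeE8 = 30"

text \<open>The triple \<open>(d\<^sub>1, d\<^sub>2, d\<^sub>3)\<close>; the entries equal to \<open>h/2\<close> are not integers if \<open>h\<close> is odd.\<close>

fun ade_d :: "ade \<Rightarrow> rat list" where
  "ade_d (TypeA n) = (let h = of_nat (coxeter (TypeA n)) in [1, h / 2, h / 2])"
| "ade_d (TypeD n) = (let h = of_nat (coxeter (TypeD n)) in [2, h / 2 - 1, h / 2])"
| "ade_d TypeE6 = [3, 4, 6]"
| "ade_d TypeE7 = [4, 6, 9]"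
| "ade_d TypeE8 = [6, 10, 15]"

text \<open>
  The factor \<open>\<theta>(x\<^sup>h\<^sup>-\<^sup>d, q) / \<theta>(x\<^sup>d, q)\<close>, read as \<open>1\<close> if \<open>d = h/2\<close>. All other entries \<open>d\<close>
  of \<^const>\<open>ade_d\<close> are integers, so that rounding the exponents down is harmless.
\<close>

definition theta_factor :: "nat \<Rightarrow> rat \<Rightarrow> complex \<Rightarrow> complex \<Rightarrow> complex" where
  "theta_factor h d x q =
     (if d = of_nat h / 2 then 1
      else theta (x powi \<lfloor>of_nat h - d\<rfloor>) q / theta (x powi \<lfloor>d\<rfloor>) q)"


text \<open>
  A linear form in the formal symbols \<open>\<chi>\<^sub>i\<close> is represented by its coefficients: for instance,
  \<open>chi [i, j]\<close> is \<open>\<chi>\<^sub>i + \<chi>\<^sub>j\<close>. For such forms \<open>a\<close> and \<open>b\<close>, \<open>sesq a b l m\<close> is the coefficient of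
  \<open>\<chi>\<^sub>l cnj \<chi>\<^sub>m\<close> in \<open>a cnj b\<close>, and \<open>abs2 a\<close> stands for \<open>|a|\<^sup>2\<close>.
\<close>

definition chi :: "nat list \<Rightarrow> nat \<Rightarrow> int" where
  "chi is l = (\<Sum>i\<leftarrow>is. of_bool (l = i))"

definition sesq :: "(nat \<Rightarrow> int) \<Rightarrow> (nat \<Rightarrow> int) \<Rightarrow> nat \<Rightarrow> nat \<Rightarrow> int" where
  "sesq a b l l' = a l * b l'"

definition abs2 :: "(nat \<Rightarrow> int) \<Rightarrow> nat \<Rightarrow> nat \<Rightarrow> int" where
  "abs2 a = sesq a a"

fun ade_N :: "ade \<Rightarrow> nat \<Rightarrow> nat \<Rightarrow> int" where
  "ade_N (TypeA n) l l' = (\<Sum>i=1..coxeter (TypeA n) - 1. abs2 (chi [i]) l l')"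
| "ade_N (TypeD n) l l' =
     (let h = coxeter (TypeD n) in
      if odd (h div 2) then
        (\<Sum>i=1..(h - 2) div 4. abs2 (chi [2*i - 1, h - (2*i - 1)]) l l')
        + 2 * abs2 (chi [h div 2]) l l'
      else
        (\<Sum>i=1..h div 2. abs2 (chi [2*i - 1]) l l')
        + abs2 (chi [h div 2]) l l'
        + (\<Sum>i=1..h div 4 - 1.
             sesq (chi [2*i]) (chi [h - 2*i]) l l' + sesq (chi [h - 2*i]) (chi [2*i]) l l'))"
| "ade_N TypeE6 l l' =
     abs2 (chi [1, 7]) l l' + abs2 (chi [4, 8]) l l' + abs2 (chi [5, 11]) l l'"
| "ade_N TypeE7 l l' =
     abs2 (chi [1, 17]) l l' + abs2 (chi [5, 13]) l l' + abs2 (chi [7, 11]) l l'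
     + abs2 (chi [9]) l l'
     + sesq (chi [3, 15]) (chi [9]) l l' + sesq (chi [9]) (chi [3, 15]) l l'"
| "ade_N TypeE8 l l' =
     abs2 (chi [1, 11, 19, 29]) l l' + abs2 (chi [7, 13, 17, 23]) l l'"

text \<open>
  The integer divisions in the exponents are exact for all \<open>l\<close>, \<open>l'\<close> with
  \<open>ade_N T l l' \<noteq> 0\<close>; see \<open>ade_N_nonzeroD\<close> below.
\<close>

definition JJ :: "nat \<Rightarrow> nat \<Rightarrow> nat \<Rightarrow> complex \<Rightarrow> complex \<Rightarrow> complex" where
  "JJ h l l' x q =
     q powi (((int l)\<^sup>2 - (int l')\<^sup>2) div (4 * int h)) * x ^ (l' - 1) *
     (theta (x ^ h) q * theta (q ^ l) (q ^ h) /
      (theta (q powi ((int l + int l') div 2) * x powi (- int h)) (q ^ h) *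
       theta (q powi ((int l - int l') div 2) * x ^ h) (q ^ h)))"


lemma chi_nonzeroD: "chi is l \<noteq> 0 \<Longrightarrow> l \<in> set is"
  by (induction "is") (auto simp: chi_def of_bool_def split: if_splits)

lemma sesq_nonzeroD: "sesq (chi is) (chi js) l l' \<noteq> 0 \<Longrightarrow> l \<in> set is \<and> l' \<in> set js"
  by (auto simp: sesq_def dest: chi_nonzeroD)

lemma abs2_nonzeroD: "abs2 (chi is) l l' \<noteq> 0 \<Longrightarrow> l \<in> set is \<and> l' \<in> set is"
  unfolding abs2_def by (rule sesq_nonzeroD)

lemma dvd_reflected_squares:
  fixes l h :: int
  assumes "4 dvd 2 * l - h"
  shows "even (l - (h - l))" "4 * h dvd l\<^sup>2 - (h - l)\<^sup>2"
proof -
  obtain k where k: "2 * l - h = 4 * k" using assms by (elim dvdE)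
  have "l - (h - l) = 2 * (2 * k)"
    using k by linarith
  then show "even (l - (h - l))"
    by (metis dvd_triv_left)
  have "l\<^sup>2 - (h - l)\<^sup>2 = h * (2 * l - h)"
    by (simp add: power2_eq_square algebra_simps)
  then show "4 * h dvd l\<^sup>2 - (h - l)\<^sup>2"
    using k by simp
qed

lemma ade_N_nonzeroD:
  assumes "ade_N T l l' \<noteq> 0"
  shows "even (int l - int l')" "4 * int (coxeter T) dvd (int l)\<^sup>2 - (int l')\<^sup>2"
proof -
  have "even (int l - int l') \<and> 4 * int (coxeter T) dvd (int l)\<^sup>2 - (int l')\<^sup>2"
  proof (cases T)
    case (TypeA n)
    then have "l = l'"
      using assms by (auto elim!: sum.not_neutral_contains_not_neutral dest!: abs2_nonzeroD)
    then show ?thesis by simp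
  next
    case (TypeD n)
    define h where "h = coxeter T"
    have h: "h = 2 * (n - 1)" using TypeD by (simp add: h_def)
    have "l = l' \<or> (int l' = int h - int l \<and> 4 dvd 2 * int l - int h)"
    proof (cases "odd (h div 2)")
      case True
      then have "(\<Sum>i=1..(h - 2) div 4. abs2 (chi [2*i - 1, h - (2*i - 1)]) l l') \<noteq> 0
                 \<or> abs2 (chi [h div 2]) l l' \<noteq> 0"
        using assms TypeD by (auto simp: Let_def h)
      then show ?thesis
      proof
        assume "abs2 (chi [h div 2]) l l' \<noteq> 0"
        then show ?thesis by (auto dest: abs2_nonzeroD)
      next
        assume "(\<Sum>i=1..(h - 2) div 4. abs2 (chi [2*i - 1, h - (2*i - 1)]) l l') \<noteq> 0"
        then obtain i where i: "i \<in> {1..(h - 2) div 4}"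
          "abs2 (chi [2*i - 1, h - (2*i - 1)]) l l' \<noteq> 0"
          by (auto elim!: sum.not_neutral_contains_not_neutral)
        have "l \<in> {2*i - 1, h - (2*i - 1)}" "l' \<in> {2*i - 1, h - (2*i - 1)}"
          using abs2_nonzeroD[OF i(2)] by simp_all
        moreover obtain k where k: "h = 4 * k + 2"
        proof -
          obtain k where "h div 2 = 2 * k + 1" using True by (rule oddE)
          with h that show ?thesis by force
        qed
        moreover have "1 \<le> i" "i \<le> k"
          using i(1) k by auto
        moreover have "2 * int (2*i - 1) - int h = 4 * (int i - int k - 1)"
            "2 * int (h - (2*i - 1)) - int h = 4 * (int k - int i + 1)"
            "int (h - (2*i - 1)) = int h - int (2*i - 1)"
            "int (2*i - 1) = int h - int (h - (2*i - 1))"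
          using k \<open>1 \<le> i\<close> \<open>i \<le> k\<close> by (simp_all add: of_nat_diff)
        ultimately show ?thesis
          by (metis dvd_triv_left insertE empty_iff)
      qed
    next
      case False
      then have "(\<Sum>i=1..h div 2. abs2 (chi [2*i - 1]) l l') \<noteq> 0
                 \<or> abs2 (chi [h div 2]) l l' \<noteq> 0
                 \<or> (\<Sum>i=1..h div 4 - 1. sesq (chi [2*i]) (chi [h - 2*i]) l l'
                       + sesq (chi [h - 2*i]) (chi [2*i]) l l') \<noteq> 0"
        using assms TypeD by (auto simp: Let_def h)
      then consider "(\<Sum>i=1..h div 2. abs2 (chi [2*i - 1]) l l') \<noteq> 0"
        | "abs2 (chi [h div 2]) l l' \<noteq> 0"
        | "(\<Sum>i=1..h div 4 - 1. sesq (chi [2*i]) (chi [h - 2*i]) l l'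
                       + sesq (chi [h - 2*i]) (chi [2*i]) l l') \<noteq> 0"
        by blast
      then show ?thesis
      proof cases
        case 1
        then show ?thesis
          by (auto elim!: sum.not_neutral_contains_not_neutral dest!: abs2_nonzeroD)
      next
        case 2
        then show ?thesis by (auto dest: abs2_nonzeroD)
      next
        case 3
        then obtain i where i: "i \<in> {1..h div 4 - 1}"
          "sesq (chi [2*i]) (chi [h - 2*i]) l l' + sesq (chi [h - 2*i]) (chi [2*i]) l l' \<noteq> 0"
          by (auto elim!: sum.not_neutral_contains_not_neutral)
        then have "sesq (chi [2*i]) (chi [h - 2*i]) l l' \<noteq> 0
                   \<or> sesq (chi [h - 2*i]) (chi [2*i]) l l' \<noteq> 0"
          by auto
        then have "l = 2*i \<and> l' = h - 2*i \<or> l = h - 2*i \<and> l' = 2*i"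
          by (auto dest: sesq_nonzeroD)
        moreover obtain k where k: "h = 4 * k"
        proof -
          obtain k where "h div 2 = 2 * k" using False by blast
          with h that show ?thesis by force
        qed
        moreover have "i \<le> k"
          using i(1) k by auto
        moreover have "2 * int (2*i) - int h = 4 * (int i - int k)"
            "2 * int (h - 2*i) - int h = 4 * (int k - int i)"
            "int (h - 2*i) = int h - int (2*i)"
            "int (2*i) = int h - int (h - 2*i)"
          using k \<open>i \<le> k\<close> by (simp_all add: of_nat_diff)
        ultimately show ?thesis
          by (metis dvd_triv_left)
      qed
    qed
    then show ?thesis
      unfolding h_def by (metis dvd_reflected_squares diff_self dvd_0_right)
  next
    case TypeE6
    then have "abs2 (chi [1, 7]) l l' \<noteq> 0 \<or> abs2 (chi [4, 8]) l l' \<noteq> 0 \<or>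
               abs2 (chi [5, 11]) l l' \<noteq> 0"
      using assms by auto
    then show ?thesis using TypeE6 by (auto dest!: abs2_nonzeroD)
  next
    case TypeE7
    then have "abs2 (chi [1, 17]) l l' \<noteq> 0 \<or> abs2 (chi [5, 13]) l l' \<noteq> 0 \<or>
               abs2 (chi [7, 11]) l l' \<noteq> 0 \<or> abs2 (chi [9]) l l' \<noteq> 0 \<or>
               sesq (chi [3, 15]) (chi [9]) l l' \<noteq> 0 \<or> sesq (chi [9]) (chi [3, 15]) l l' \<noteq> 0"
      using assms by auto
    then show ?thesis using TypeE7 by (auto dest!: abs2_nonzeroD sesq_nonzeroD)
  next
    case TypeE8
    then have "abs2 (chi [1, 11, 19, 29]) l l' \<noteq> 0 \<or> abs2 (chi [7, 13, 17, 23]) l l' \<noteq> 0"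
      using assms by auto
    then show ?thesis using TypeE8 by (auto dest!: abs2_nonzeroD)
  qed
  then show "even (int l - int l')" "4 * int (coxeter T) dvd (int l)\<^sup>2 - (int l')\<^sup>2"
    by blast+
qed

end

(* Divide the difference of the two sides by theta(x^h, q). Under x -> q x both sides pick up the
   same factor C x^(-h(h-2)), and theta(x^h, q) picks up C' x^(-h^2), so the quotient G satisfies
   G(q x) = C'' x^(2h) G(x). If the difference has removable singularities only and vanishes wherever
   theta(x^h, q) does, then G is holomorphic on the punctured plane; the functional equation makes
   it bounded, and Liouville's theorem for G(exp z) gives G = 0.

   So it remains to compare limits at the points with x^h = q^k, that is x = y p^k with p^h = q and
   y^h = 1. Up to a common factor the left-hand side is the product of the weights -(h - d)/d over
   those d with y^d = 1 and h | k d, and J^l_l' is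
   [h | k - (l+l')/2] y^(-(l-l')/2) - [h | k + (l-l')/2] y^((l+l')/2).
   The resulting identities for N_(l,l') are sums over residues in types A and D and finite
   polynomial identities modulo y^h = 1 in type E. *)

theory Submission
  imports Defs
begin

section \<open>Theta functions\<close>

text \<open>The criterion is a count of zeros. A nonzero holomorphic function with f(q x) = C x^(-n)
  f(x) has n zeros in each annulus |q| r < |x| <= r. The difference of the two sides has n = h(h-2),
  but there are h^2 points with x^h = q^k in such an annulus: each k has h of them, and x -> q x
  raises k by h. So agreement at these points leaves 2h zeros too many. They are also the points
  where both sides can be evaluated. The denominators of J vanish only there, and the zero of
  theta(x^h, q) cancels them; on the left, x^(h-d) = q^k / x^d relates each numerator to its
  denominator by inversion. The functional equations and the common factor of the limits agree
  because all exponents on the left are linear in d and d_1 + d_2 + d_3 = h + 1. One obstacle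
  remains: a degree that need not divide h (4 in E7, h/2 - 1 in D) can have poles away from these
  points, and they have to be cancelled by the numerator of another factor.\<close>

lemma qpoch_inf_convergent_prod:
  fixes x q :: complex
  assumes "norm q < 1"
  shows "convergent_prod (\<lambda>n. 1 - x * q ^ n)"
proof (rule abs_convergent_prod_imp_convergent_prod)
  have "summable (\<lambda>n. norm x * norm q ^ n)"
    using assms by (intro summable_mult summable_geometric) auto
  then show "abs_convergent_prod (\<lambda>n. 1 - x * q ^ n)"
    by (simp add: abs_convergent_prod_conv_summable norm_mult norm_power)
qed

lemma qpoch_inf_uniform_limit:
  assumes "norm q < 1"
  shows "uniform_limit (cball 0 R) (\<lambda>N x. \<Prod>n<N. 1 - x * q ^ n) (\<lambda>x. qpoch_inf x q) sequentially"
proof -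
  have "uniformly_convergent_on (cball 0 R) (\<lambda>N x. \<Prod>n<N. 1 - x * q ^ n)"
  proof (rule uniformly_convergent_on_prod')
    show "uniformly_convergent_on (cball 0 R) (\<lambda>N x. \<Sum>n<N. norm (1 - x * q ^ n - 1))"
    proof (rule Weierstrass_m_test')
      show "summable (\<lambda>n. R * norm q ^ n)"
        using assms by (intro summable_mult summable_geometric) auto
    qed (auto simp: norm_mult norm_power intro!: mult_right_mono)
  qed (auto intro!: continuous_intros)
  then obtain g where
    g: "uniform_limit (cball 0 R) (\<lambda>N x. \<Prod>n<N. 1 - x * q ^ n) g sequentially"
    by (auto simp: uniformly_convergent_on_def)
  have "g x = qpoch_inf x q" if "x \<in> cball 0 R" for x
  proof (rule LIMSEQ_unique)
    show "(\<lambda>N. \<Prod>n<N. 1 - x * q ^ n) \<longlonglongrightarrow> g x"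
      using g that by (rule tendsto_uniform_limitI)
    show "(\<lambda>N. \<Prod>n<N. 1 - x * q ^ n) \<longlonglongrightarrow> qpoch_inf x q"
      using convergent_prod_LIMSEQ[OF qpoch_inf_convergent_prod[OF assms, of x]]
      by (simp add: qpoch_inf_def LIMSEQ_lessThan_iff_atMost)
  qed
  with g show ?thesis
    by (subst uniform_limit_cong'[where g = "\<lambda>N x. \<Prod>n<N. 1 - x * q ^ n" and i = g]) auto
qed

lemma qpoch_inf_holomorphic:
  assumes "norm q < 1"
  shows "(\<lambda>x. qpoch_inf x q) holomorphic_on UNIV"
proof (rule holomorphic_uniform_sequence)
  fix z :: complex
  have "uniform_limit (cball z 1) (\<lambda>N x. \<Prod>n<N. 1 - x * q ^ n) (\<lambda>x. qpoch_inf x q) sequentially"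
    using qpoch_inf_uniform_limit[OF assms, of "norm z + 1"]
    by (rule uniform_limit_on_subset) (simp add: cball_subset_cball_iff)
  then show "\<exists>d>0. cball z d \<subseteq> UNIV \<and>
      uniform_limit (cball z d) (\<lambda>N x. \<Prod>n<N. 1 - x * q ^ n) (\<lambda>x. qpoch_inf x q) sequentially"
    by (intro exI[of _ 1]) auto
qed (auto intro!: holomorphic_intros)

lemma qpoch_inf_eq_0_iff:
  assumes "norm q < 1"
  shows "qpoch_inf x q = 0 \<longleftrightarrow> (\<exists>n. x * q ^ n = 1)"
proof -
  have "(\<lambda>n. 1 - x * q ^ n) has_prod qpoch_inf x q"
    unfolding qpoch_inf_def by (rule convergent_prod_has_prod[OF qpoch_inf_convergent_prod[OF assms]])
  from has_prod_eq_0_iff[OF this] show ?thesis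
    by (force simp: image_iff)
qed

lemma qpoch_inf_rec:
  assumes "norm q < 1"
  shows "qpoch_inf x q = (1 - x) * qpoch_inf (q * x) q"
proof (cases "x = 1")
  case True
  have "qpoch_inf 1 q = 0"
    using qpoch_inf_eq_0_iff[OF assms, of 1] by (metis mult_1 power_0)
  with True show ?thesis by simp
next
  case False
  have "(\<Prod>n. 1 - x * q ^ Suc n) = qpoch_inf x q / (1 - x)"
    unfolding qpoch_inf_def
    using prodinf_split_head[OF qpoch_inf_convergent_prod[OF assms, of x]] False by simp
  then show ?thesis
    using False by (simp add: qpoch_inf_def mult_ac)
qed

lemma qpoch_inf_self_nonzero:
  assumes "norm q < 1"
  shows "qpoch_inf q q \<noteq> 0"
proof
  assume "qpoch_inf q q = 0"
  then obtain n where "q * q ^ n = 1"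
    using qpoch_inf_eq_0_iff[OF assms] by blast
  then have n: "q ^ Suc n = 1" by (simp only: power_Suc)
  have "norm q ^ Suc n \<le> norm q ^ 1"
    using assms by (intro power_decreasing) auto
  also have "\<dots> < 1"
    using assms by simp
  finally have "norm q ^ Suc n < 1" .
  with n show False
    by (metis norm_one norm_power order_less_irrefl)
qed

text \<open>The exponent of q (up to sign) that n shifts of \<open>theta\<close> accumulate. It is
  defined on the integers because shifts go both ways; the division is exact.\<close>

definition tri :: "int \<Rightarrow> int" where
  "tri n = n * (n - 1) div 2"

lemma two_tri: "2 * tri n = n * (n - 1)"
  unfolding tri_def by (rule dvd_mult_div_cancel) simp

lemma tri_succ: "tri (n + 1) = tri n + n"
  using two_tri[of n] two_tri[of "n + 1"] by (simp add: algebra_simps)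

lemma minus_one_powi_square [simp]: "(-1 :: complex) powi n * (-1) powi n = 1"
  by (simp flip: power_int_mult_distrib)

lemma minus_one_powi_even: "even n \<Longrightarrow> (-1 :: complex) powi n = 1"
  by (elim evenE) (simp add: power_int_mult)

lemma minus_one_powi_odd: "odd n \<Longrightarrow> (-1 :: complex) powi n = -1"
  by (elim oddE) (simp add: power_int_mult power_int_add)

section \<open>Quasi-periodicity, zeros and derivatives of theta\<close>

locale nome =
  fixes q :: complex
  assumes q_nonzero: "q \<noteq> 0" and norm_q: "norm q < 1"
begin

lemma theta_holomorphic: "(\<lambda>x. theta x q) holomorphic_on - {0}"
proof -
  have 1: "(\<lambda>x. qpoch_inf x q) holomorphic_on - {0}"
    using qpoch_inf_holomorphic[OF norm_q] by (rule holomorphic_on_subset) simp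
  have "((\<lambda>x. qpoch_inf x q) \<circ> (\<lambda>x. q / x)) holomorphic_on - {0}"
    by (rule holomorphic_on_compose_gen[OF _ qpoch_inf_holomorphic[OF norm_q]])
      (auto intro!: holomorphic_intros)
  then show ?thesis
    unfolding theta_def using qpoch_inf_self_nonzero[OF norm_q] 1
    by (intro holomorphic_intros) (auto simp: o_def)
qed

text \<open>Passing to q x removes 1 - x from the first product and adds 1 - 1/x to the second, and
  1 - x = -x (1 - 1/x). Keeping this factor as \<open>c\<close> instead of dividing by it covers x =
  1 as well.\<close>

lemma theta_shift:
  assumes "x \<noteq> 0"
  shows "theta (q * x) q = - theta x q / x"
proof -
  define A B c where "A = qpoch_inf (q * x) q" and "B = qpoch_inf (q / x) q" and "c = 1 - 1 / x"
  have "qpoch_inf (1 / x) q = c * B"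
    using qpoch_inf_rec[OF norm_q, of "1 / x"] by (simp add: B_def c_def)
  moreover have "qpoch_inf x q = - (c * x) * A"
    using qpoch_inf_rec[OF norm_q, of x] assms by (simp add: A_def c_def left_diff_distrib)
  moreover have "q / (q * x) = 1 / x"
    using q_nonzero by simp
  ultimately show ?thesis
    using assms by (simp add: theta_def flip: A_def B_def)
qed

lemma theta_shift_powi:
  assumes "x \<noteq> 0"
  shows "theta (q powi n * x) q = (-1) powi n * q powi (- tri n) * x powi (- n) * theta x q"
proof -
  have step: "theta (q powi (n + 1) * x) q = - theta (q powi n * x) q * q powi (- n) / x" for n
  proof -
    have "theta (q * (q powi n * x)) q = - theta (q powi n * x) q / (q powi n * x)"
      using assms q_nonzero by (intro theta_shift) auto
    then show ?thesis
      using q_nonzero by (simp add: power_int_add power_int_minus mult_ac divide_simps)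
  qed
  define P where "P n \<longleftrightarrow>
    theta (q powi n * x) q = (-1) powi n * q powi (- tri n) * x powi (- n) * theta x q" for n
  \<comment> \<open>An equivalence, so that it serves both directions of the integer
    induction.\<close>
  have iff: "P (n + 1) \<longleftrightarrow> P n" for n
  proof -
    have "(-1) powi (n + 1) * q powi (- tri (n + 1)) * x powi (- (n + 1)) * theta x q =
       - ((-1) powi n * q powi (- tri n) * x powi (- n) * theta x q) * q powi (- n) / x"
      using assms q_nonzero
      by (simp add: tri_succ power_int_add power_int_diff power_int_minus divide_simps)
    then show ?thesis
      unfolding P_def step using assms q_nonzero by (simp add: divide_simps)
  qed
  have "P n"
  proof (induction n rule: int_induct[of _ 0])
    case base
    then show ?case by (simp add: P_def tri_def)
  next
    case (step1 i)
    then show ?case by (simp add: iff)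
  next
    case (step2 i)
    then show ?case using iff[of "i - 1"] by simp
  qed
  then show ?thesis by (simp add: P_def)
qed

lemma theta_one: "theta 1 q = 0"
  using qpoch_inf_rec[OF norm_q, of 1] by (simp add: theta_def)

lemma theta_q_powi: "theta (q powi n) q = 0"
  using theta_shift_powi[of 1 n] by (simp add: theta_one)

lemma theta_eq_0_iff:
  assumes "x \<noteq> 0"
  shows "theta x q = 0 \<longleftrightarrow> (\<exists>n::int. x = q powi n)"
proof
  assume "theta x q = 0"
  then have "qpoch_inf x q = 0 \<or> qpoch_inf (q / x) q = 0"
    using qpoch_inf_self_nonzero[OF norm_q] by (simp add: theta_def)
  then show "\<exists>n::int. x = q powi n"
  proof
    assume "qpoch_inf x q = 0"
    then obtain n where "x * q ^ n = 1"
      using qpoch_inf_eq_0_iff[OF norm_q] by auto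
    then have "x = q powi (- int n)"
      using q_nonzero by (simp add: power_int_minus field_simps)
    then show ?thesis ..
  next
    assume "qpoch_inf (q / x) q = 0"
    then obtain n where "q / x * q ^ n = 1"
      using qpoch_inf_eq_0_iff[OF norm_q] by auto
    then have "x = q powi (int (Suc n))"
      using assms unfolding power_int_of_nat by (simp add: field_simps)
    then show ?thesis ..
  qed
next
  assume "\<exists>n::int. x = q powi n"
  then show "theta x q = 0" by (auto simp: theta_q_powi)
qed

text \<open>The zero at 1 comes from the single factor 1 - x. The remaining product is the square of
  \<open>qpoch_inf q q\<close> at x = 1, which the normalisation of \<open>theta\<close> divides
  out.\<close>

lemma theta_deriv_one: "((\<lambda>x. theta x q) has_field_derivative -1) (at 1)"
proof -
  define c where "c = qpoch_inf q q"
  have c: "c \<noteq> 0" unfolding c_def by (rule qpoch_inf_self_nonzero[OF norm_q])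
  define g where "g x = qpoch_inf (q * x) q * qpoch_inf (q / x) q / c\<^sup>2" for x
  have [holomorphic_intros]: "(\<lambda>x. qpoch_inf (f x) q) holomorphic_on - {0}" if "f holomorphic_on - {0}" for f
    using holomorphic_on_compose_gen[OF that qpoch_inf_holomorphic[OF norm_q]] by (simp add: o_def)
  then have "g holomorphic_on - {0}"
    unfolding g_def using c by (intro holomorphic_intros) auto
  then have "g field_differentiable (at 1)"
    by (auto intro!: holomorphic_on_imp_differentiable_at[of _ "- {0}"] open_Compl)
  then obtain g' where g': "(g has_field_derivative g') (at 1)"
    by (auto simp: field_differentiable_def)
  have "g 1 = 1"
    using c by (simp add: g_def c_def power2_eq_square)
  have "theta x q = (1 - x) * g x" for x
    using qpoch_inf_rec[OF norm_q, of x] by (simp add: theta_def g_def c_def)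
  moreover have "((\<lambda>x. (1 - x) * g x) has_field_derivative -1) (at 1)"
    using g' \<open>g 1 = 1\<close> by (auto intro!: derivative_eq_intros)
  ultimately show ?thesis by simp
qed

text \<open>Shifts carry every zero of \<open>theta\<close> to 1: c x^n = q^m (x / x0)^n. All later
  uses of l'Hopital's rule rest on this derivative.\<close>

lemma theta_powi_deriv:
  assumes "x\<^sub>0 \<noteq> 0" "c * x\<^sub>0 powi n = q powi m"
  shows "((\<lambda>x. theta (c * x powi n) q) has_field_derivative
           of_int n / x\<^sub>0 * (-1) powi (m + 1) * q powi (- tri m)) (at x\<^sub>0)"
proof -
  define g where "g x = (-1) powi m * q powi (- tri m) * ((x / x\<^sub>0) powi n) powi (- m) *
    theta ((x / x\<^sub>0) powi n) q" for x
  have eq: "theta (c * x powi n) q = g x" if "x \<noteq> 0" for x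
  proof -
    have "c * x powi n = q powi m * (x / x\<^sub>0) powi n"
      using assms by (simp add: power_int_divide_distrib field_simps)
    then show ?thesis
      using that assms by (simp add: g_def theta_shift_powi)
  qed
  have th: "((\<lambda>x. theta ((x / x\<^sub>0) powi n) q) has_field_derivative -1 * (of_int n / x\<^sub>0)) (at x\<^sub>0)"
  proof (rule DERIV_chain'[where g = "\<lambda>y. theta y q"])
    show "((\<lambda>x. (x / x\<^sub>0) powi n) has_field_derivative of_int n / x\<^sub>0) (at x\<^sub>0)"
      using assms by (auto intro!: derivative_eq_intros)
    show "((\<lambda>y. theta y q) has_field_derivative -1) (at ((x\<^sub>0 / x\<^sub>0) powi n))"
      using assms theta_deriv_one by simp
  qed
  have f: "((\<lambda>x. (-1) powi m * q powi (- tri m) * ((x / x\<^sub>0) powi n) powi (- m))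
      has_field_derivative (-1) powi m * q powi (- tri m) * of_int (n * - m) / x\<^sub>0) (at x\<^sub>0)"
    using assms by (auto intro!: derivative_eq_intros simp flip: power_int_mult)
  \<comment> \<open>The derivative of the prefactor drops out of the product rule because
    \<open>theta 1 q = 0\<close>.\<close>
  have "(g has_field_derivative of_int n / x\<^sub>0 * (-1) powi (m + 1) * q powi (- tri m)) (at x\<^sub>0)"
    unfolding g_def using DERIV_mult[OF f th] assms
    by (simp add: theta_one power_int_add mult_ac)
  then show ?thesis
  proof (rule has_field_derivative_transform_within_open[where S = "- {0}"])
    show "g x = theta (c * x powi n) q" if "x \<in> - {0}" for x
      using that eq by simp
  qed (use assms in auto)
qed

lemma theta_powi_analytic:
  assumes "c \<noteq> 0" "x\<^sub>0 \<noteq> 0"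
  shows "(\<lambda>x. theta (c * x powi n) q) analytic_on {x\<^sub>0}"
proof -
  have "((\<lambda>y. theta y q) \<circ> (\<lambda>x. c * x powi n)) holomorphic_on - {0}"
    by (rule holomorphic_on_compose_gen[OF _ theta_holomorphic])
      (use assms in \<open>auto intro!: holomorphic_intros\<close>)
  then have "(\<lambda>x. theta (c * x powi n) q) analytic_on - {0}"
    by (subst analytic_on_open) (auto simp: o_def)
  then show ?thesis
    by (rule analytic_on_subset) (use assms in auto)
qed

lemma theta_powi_isCont:
  assumes "c \<noteq> 0" "x\<^sub>0 \<noteq> 0"
  shows "isCont (\<lambda>x. theta (c * x powi n) q) x\<^sub>0"
  using theta_powi_analytic[OF assms] by (rule analytic_at_imp_isCont)

lemma norm_powi_inj: "norm q powi m = norm q powi n \<longleftrightarrow> m = n"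
  using power_int_strict_decreasing[of m n "norm q"] power_int_strict_decreasing[of n m "norm q"]
    norm_q q_nonzero by (metis less_irrefl linorder_neqE zero_less_norm_iff)

lemma powi_inj: "q powi m = q powi n \<longleftrightarrow> m = n"
  by (metis norm_power_int norm_powi_inj)

section \<open>A vanishing criterion\<close>

text \<open>The closed annulus \<open>K\<close> meets every orbit of x -> q x. Its outer radius
  \<open>r\<close> is where the multiplier C x^n has modulus 1, so the modulus is at most 1 inside
  and at least 1 outside. Hence a bound on \<open>K\<close> persists inwards by g(q x) = C x^n g(x),
  and outwards by solving this equation for g(x).\<close>

lemma quasi_periodic_bounded:
  assumes holo: "g holomorphic_on - {0}"
    and shift: "\<And>x. x \<noteq> 0 \<Longrightarrow> g (q * x) = C * x ^ n * g x"
    and "n > 0" "C \<noteq> 0"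
  shows "\<exists>M. \<forall>x. x \<noteq> 0 \<longrightarrow> norm (g x) \<le> M"
proof -
  define a where "a = norm q"
  have a: "0 < a" "a < 1" using q_nonzero norm_q by (auto simp: a_def)
  define r where "r = root n (1 / norm C)"
  have r: "0 < r" "norm C * r ^ n = 1"
    using assms(3,4) by (auto simp: r_def)
  define K where "K = {x::complex. a * r \<le> norm x \<and> norm x \<le> r}"
  have "K = cball 0 r - ball 0 (a * r)"
    by (auto simp: K_def)
  then have "compact K"
    by (simp add: compact_diff)
  moreover have "K \<subseteq> - {0}"
    using a r by (auto simp: K_def mult_le_0_iff)
  ultimately have "compact (g ` K)"
    using holo by (intro compact_continuous_image) (auto intro: holomorphic_on_imp_continuous_on holomorphic_on_subset)
  then obtain M where M: "norm (g x) \<le> M" if "x \<in> K" for x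
    using compact_imp_bounded[of "g ` K"] by (auto simp: bounded_iff)
  have inside: "norm (g x) \<le> M" if "a ^ Suc m * r \<le> norm x" "norm x \<le> r" for m x
    using that
  proof (induction m arbitrary: x)
    case 0
    then show ?case by (intro M) (auto simp: K_def)
  next
    case (Suc m)
    show ?case
    proof (cases "a * r \<le> norm x")
      case True
      with Suc.prems show ?thesis by (intro M) (auto simp: K_def)
    next
      case False
      define y where "y = x / q"
      have x: "x = q * y" using q_nonzero by (simp add: y_def)
      then have nx: "norm x = a * norm y" by (simp add: norm_mult a_def)
      have y: "a ^ Suc m * r \<le> norm y" "norm y \<le> r"
        using Suc.prems False a nx by (auto simp: mult.assoc)
      have "y \<noteq> 0"
        using y a r by (metis norm_zero not_less zero_less_mult_iff zero_less_power)
      have "norm C * norm y ^ n \<le> norm C * r ^ n"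
        using y by (intro mult_left_mono power_mono) auto
      then have "norm C * norm y ^ n * norm (g y) \<le> 1 * M"
        using Suc.IH[OF y] r by (intro mult_mono) auto
      then show ?thesis
        using shift[OF \<open>y \<noteq> 0\<close>] by (simp add: x norm_mult norm_power)
    qed
  qed
  have outside: "norm (g x) \<le> M" if "a * r \<le> norm x" "a ^ m * norm x \<le> r" for m x
    using that
  proof (induction m arbitrary: x)
    case 0
    then show ?case by (intro M) (auto simp: K_def)
  next
    case (Suc m)
    show ?case
    proof (cases "norm x \<le> r")
      case True
      with Suc.prems show ?thesis by (intro M) (auto simp: K_def)
    next
      case False
      then have "x \<noteq> 0" using r by auto
      have nx: "norm (q * x) = a * norm x" by (simp add: norm_mult a_def)
      have "norm (g (q * x)) \<le> M"
        using Suc.prems False a by (intro Suc.IH) (auto simp: nx mult_ac)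
      moreover have "norm C * r ^ n \<le> norm C * norm x ^ n"
        using False r by (intro mult_left_mono power_mono) auto
      then have "1 * norm (g x) \<le> norm C * norm x ^ n * norm (g x)"
        using r by (intro mult_right_mono) auto
      ultimately show ?thesis
        using shift[OF \<open>x \<noteq> 0\<close>] by (simp add: norm_mult norm_power)
    qed
  qed
  have "norm (g x) \<le> M" if x: "x \<noteq> 0" for x
  proof (cases "norm x \<le> r")
    case True
    obtain m where "a ^ m < norm x / r"
      using real_arch_pow_inv[of "norm x / r" a] a r x by auto
    then have "a ^ m * r < norm x"
      using r by (simp add: field_simps)
    moreover have "a ^ Suc m * r \<le> a ^ m * r"
      using a r by (simp add: mult_left_le_one_le)
    ultimately show ?thesis
      using True by (intro inside[of m]) auto
  next
    case False
    then have "norm x > 0" using r by linarith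
    obtain m where "a ^ m < r / norm x"
      using real_arch_pow_inv[of "r / norm x" a] a r \<open>norm x > 0\<close> by auto
    then have "a ^ m * norm x < r"
      using \<open>norm x > 0\<close> by (simp add: field_simps)
    moreover have "a * r \<le> norm x"
      using False a r by (smt (verit) mult_left_le_one_le)
    ultimately show ?thesis
      by (intro outside[of _ m]) auto
  qed
  then show ?thesis by blast
qed

lemma quasi_periodic_eq_0:
  assumes holo: "g holomorphic_on - {0}"
    and shift: "\<And>x. x \<noteq> 0 \<Longrightarrow> g (q * x) = C * x ^ n * g x"
    and "n > 0" "x \<noteq> 0"
  shows "g x = 0"
proof (cases "C = 0")
  case True
  then show ?thesis
    using shift[of "x / q"] q_nonzero \<open>x \<noteq> 0\<close> by simp
next
  case False
  obtain M where M: "norm (g x) \<le> M" if "x \<noteq> 0" for x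
    using quasi_periodic_bounded[OF holo shift \<open>n > 0\<close> False] by auto
  have "(g \<circ> exp) holomorphic_on UNIV"
    by (rule holomorphic_on_compose_gen[OF _ holo]) (auto intro: holomorphic_intros)
  moreover have "bounded (range (g \<circ> exp))"
    unfolding bounded_iff using M by (intro exI[of _ M]) auto
  ultimately have "(g \<circ> exp) constant_on UNIV"
    by (rule Liouville_theorem)
  then obtain c where "g (exp z) = c" for z
    by (auto simp: constant_on_def)
  then have c: "g y = c" if "y \<noteq> 0" for y
    using that by (metis exp_Ln)
  \<comment> \<open>A constant c can satisfy the functional equation at both x = 1 and x = 2 only if
    2^n c = c.\<close>
  have "C * c = c" "C * 2 ^ n * c = c"
    using shift[of 1] shift[of 2] q_nonzero by (simp_all add: c)
  moreover have "C * 2 ^ n * c = 2 ^ n * (C * c)"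
    by simp
  ultimately have "2 ^ n * c = c"
    by metis
  moreover have "(2::complex) ^ n \<noteq> 1"
  proof
    assume "(2::complex) ^ n = 1"
    then have "(2::real) ^ n = 1"
      by (metis norm_numeral norm_one norm_power)
    then show False
      using one_less_power[of "2::real" n] \<open>n > 0\<close> by simp
  qed
  ultimately have "c = 0" by simp
  with c \<open>x \<noteq> 0\<close> show ?thesis by simp
qed

text \<open>The hypotheses speak of limits because values at poles are arbitrary;
  \<open>remove_sings\<close> supplies the continuations. The exponent of x in \<open>shift\<close>
  exceeds that of theta(x^h, q) by 2 h, the positive exponent required by
  \<open>quasi_periodic_eq_0\<close>.\<close>

lemma meromorphic_eq_0I:
  assumes "h > 0"
    and mero: "f meromorphic_on - {0}"
    and lim: "\<And>x\<^sub>0. x\<^sub>0 \<noteq> 0 \<Longrightarrow> \<exists>L. f \<midarrow>x\<^sub>0\<rightarrow> L"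
    and zero: "\<And>x\<^sub>0 k. x\<^sub>0 \<noteq> 0 \<Longrightarrow> x\<^sub>0 ^ h = q powi k \<Longrightarrow> f \<midarrow>x\<^sub>0\<rightarrow> 0"
    and shift: "\<And>x. x \<noteq> 0 \<Longrightarrow> f (q * x) = C * x powi (- (int h * (int h - 2))) * f x"
    and "z \<noteq> 0"
  shows "\<forall>\<^sub>F x in at z. f x = 0"
proof -
  define T where "T x = theta (x ^ h) q" for x
  define G where "G x = f x / T x" for x
  have T_alt: "T = (\<lambda>x. theta (1 * x powi int h) q)"
    by (simp add: T_def fun_eq_iff)
  have T_analytic: "T analytic_on {x}" if "x \<noteq> 0" for x
    unfolding T_alt using that by (intro theta_powi_analytic) auto
  have "T meromorphic_on - {0}"
    using T_analytic by (subst meromorphic_on_meromorphic_at) (auto intro: analytic_on_imp_meromorphic_on)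
  then have "G meromorphic_on - {0}"
    unfolding G_def by (intro meromorphic_intros mero)
  then have iso: "isolated_singularity_at G x" if "x \<noteq> 0" for x
    using that by (subst (asm) meromorphic_on_meromorphic_at) (auto simp: meromorphic_at_iff)
  have G_lim: "\<exists>L. G \<midarrow>x\<rightarrow> L" if x: "x \<noteq> 0" for x
  proof (cases "T x = 0")
    case False
    have "T \<midarrow>x\<rightarrow> T x"
      using T_analytic[OF that] by (simp add: analytic_at_imp_isCont isContD)
    then show ?thesis
      using lim[OF that] False unfolding G_def by (blast intro: tendsto_divide)
  next
    case True
    then obtain k where k: "x ^ h = q powi k"
      using theta_eq_0_iff[of "x ^ h"] x by (auto simp: T_def)
    note f0 = zero[OF that k]
    have iso_f: "isolated_singularity_at f x"
      using mero that by (subst (asm) meromorphic_on_meromorphic_at) (auto simp: meromorphic_at_iff)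
    \<comment> \<open>L'Hopital's rule needs differentiability at x itself, hence the continuation
      of f, which has the value 0 at x.\<close>
    have "remove_sings f analytic_on {x}"
      by (rule remove_sings_analytic_at[OF iso_f f0])
    then obtain f' where f': "(remove_sings f has_field_derivative f') (at x)"
      using analytic_on_imp_differentiable_at[of _ "{x}" x] by (auto simp: field_differentiable_def)
    have T': "(T has_field_derivative of_nat h / x * (-1) powi (k + 1) * q powi (- tri k)) (at x)"
      unfolding T_alt using theta_powi_deriv[of x 1 "int h" k] that k by simp
    have "(\<lambda>w. remove_sings f w / T w) \<midarrow>x\<rightarrow>
        f' / (of_nat h / x * (-1) powi (k + 1) * q powi (- tri k))"
      using f0 True that q_nonzero \<open>h > 0\<close>
      by (intro lhopital_complex_simple[OF f' T']) (auto intro!: remove_sings_eqI)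
    moreover have "\<forall>\<^sub>F w in at x. remove_sings f w / T w = G w"
      using eventually_remove_sings_eq_at[OF iso_f] by eventually_elim (simp add: G_def)
    ultimately show ?thesis
      by (blast intro: Lim_transform_eventually)
  qed
  define g where "g = remove_sings G"
  have G_g: "G \<midarrow>x\<rightarrow> g x" if "x \<noteq> 0" for x
    using G_lim[OF that] unfolding g_def by (metis remove_sings_eqI)
  have "g analytic_on - {0}"
    unfolding g_def using remove_sings_analytic_at[OF iso G_g]
    by (subst analytic_on_analytic_at) auto
  then have holo: "g holomorphic_on - {0}"
    by (rule analytic_imp_holomorphic)
  define E where "E = (-1) powi int h * q powi (- tri (int h))"
  have "E \<noteq> 0" using q_nonzero by (simp add: E_def)
  have T_shift: "T (q * x) = E * x powi (- (int h * int h)) * T x" if "x \<noteq> 0" for x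
  proof -
    have "T (q * x) = theta (q powi int h * x ^ h) q"
      by (simp add: T_def power_mult_distrib)
    also have "\<dots> = E * (x ^ h) powi (- int h) * T x"
      unfolding E_def T_def using that by (intro theta_shift_powi) simp
    also have "(x ^ h) powi (- int h) = x powi (- (int h * int h))"
      by (simp only: power_int_power) simp
    finally show ?thesis .
  qed
  have G_shift: "G (q * x) = C / E * x ^ (2 * h) * G x" if "x \<noteq> 0" for x
  proof -
    have "x powi (- (int h * (int h - 2))) = x powi (int (2 * h) + - (int h * int h))"
      by (rule arg_cong[where f = "power_int x"]) (simp add: algebra_simps)
    also have "\<dots> = x powi int (2 * h) * x powi (- (int h * int h))"
      by (rule power_int_add) (use that in simp)
    also have "x powi int (2 * h) = x ^ (2 * h)"
      by (rule power_int_of_nat)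
    finally have f: "f (q * x) = C * (x ^ (2 * h) * x powi (- (int h * int h))) * f x"
      using shift[OF that] by (simp only:)
    have "x powi (- (int h * int h)) \<noteq> 0"
      using that by simp
    \<comment> \<open>At a zero of \<open>T\<close> both values of \<open>G\<close> are 0 by the
      convention for division by zero, so the equation holds for the raw values at every nonzero
      x.\<close>
    then show ?thesis
      unfolding G_def f T_shift[OF that] using that \<open>E \<noteq> 0\<close> by (cases "T x = 0") (simp_all add: divide_simps)
  qed
  have g_shift: "g (q * x) = C / E * x ^ (2 * h) * g x" if "x \<noteq> 0" for x
  proof (rule tendsto_unique)
    have "\<forall>\<^sub>F w in at x. q * w \<in> UNIV \<and> q * w \<noteq> q * x"
      using q_nonzero by (simp add: eventually_at_filter)
    then have "filterlim (\<lambda>w. q * w) (at (q * x)) (at x)"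
      unfolding filterlim_at by (intro conjI tendsto_mult tendsto_const tendsto_ident_at)
    then show "((\<lambda>w. G (q * w)) \<longlongrightarrow> g (q * x)) (at x)"
      by (rule filterlim_compose[OF G_g, rotated]) (use that q_nonzero in simp)
    have "((\<lambda>w. C / E * w ^ (2 * h) * G w) \<longlongrightarrow> C / E * x ^ (2 * h) * g x) (at x)"
      using G_g[OF that] by (intro tendsto_mult tendsto_power tendsto_const tendsto_ident_at)
    moreover have "\<forall>\<^sub>F w in at x. w \<noteq> 0"
      by (rule eventually_neq_at_within)
    then have "\<forall>\<^sub>F w in at x. C / E * w ^ (2 * h) * G w = G (q * w)"
      by eventually_elim (rule G_shift[symmetric])
    ultimately show "((\<lambda>w. G (q * w)) \<longlongrightarrow> C / E * x ^ (2 * h) * g x) (at x)"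
      by (rule Lim_transform_eventually)
  qed auto
  have g0: "g x = 0" if "x \<noteq> 0" for x
    using quasi_periodic_eq_0[OF holo g_shift] \<open>h > 0\<close> that by auto
  have "\<forall>\<^sub>F x in at z. T x \<noteq> 0"
  \<comment> \<open>\<open>G x = 0\<close> gives back \<open>f x = 0\<close> only where
    \<open>T\<close> is nonzero. The zeros of \<open>T\<close> are simple, so near z it can vanish
    at most at z itself.\<close>
  proof (cases "T z = 0")
    case False
    then show ?thesis
      using T_analytic[OF \<open>z \<noteq> 0\<close>]
      by (intro tendsto_imp_eventually_ne[of T "T z"]) (auto simp: analytic_at_imp_isCont isContD)
  next
    case True
    then obtain k where k: "z ^ h = q powi k"
      using theta_eq_0_iff[of "z ^ h"] \<open>z \<noteq> 0\<close> by (auto simp: T_def)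
    have "(T has_field_derivative of_nat h / z * (-1) powi (k + 1) * q powi (- tri k)) (at z)"
      unfolding T_alt using theta_powi_deriv[of z 1 "int h" k] \<open>z \<noteq> 0\<close> k by simp
    then have "(\<lambda>w. (T w - T z) / (w - z)) \<midarrow>z\<rightarrow> of_nat h / z * (-1) powi (k + 1) * q powi (- tri k)"
      by (simp add: has_field_derivative_iff)
    then have "\<forall>\<^sub>F w in at z. (T w - T z) / (w - z) \<noteq> 0"
      by (rule tendsto_imp_eventually_ne) (use \<open>h > 0\<close> \<open>z \<noteq> 0\<close> q_nonzero in auto)
    then show ?thesis
      by eventually_elim (use True in auto)
  qed
  moreover have "\<forall>\<^sub>F x in at z. remove_sings G x = G x"
    by (rule eventually_remove_sings_eq_at[OF iso[OF \<open>z \<noteq> 0\<close>]])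
  moreover have "\<forall>\<^sub>F x in at z. x \<noteq> 0"
    by (rule eventually_neq_at_within)
  ultimately show ?thesis
    by eventually_elim (use g0 in \<open>auto simp: G_def g_def\<close>)
qed

end

section \<open>Values of the theta quotients\<close>

lemma tri_diff: "tri (k - m) = tri k - m * (k - 1) + tri m"
proof -
  have "2 * tri (k - m) = 2 * (tri k - m * (k - 1) + tri m)"
    using two_tri[of k] two_tri[of m] two_tri[of "k - m"] by (simp add: algebra_simps)
  then show ?thesis by simp
qed

lemma tri_minus: "tri (- m) = m * m - tri m"
  using two_tri[of m] two_tri[of "- m"] by (simp add: algebra_simps)

lemma root_of_unity_norm: "y ^ h = 1 \<Longrightarrow> h > 0 \<Longrightarrow> norm (y::complex) = 1"
  using power_eq_imp_eq_base[of "norm y" h 1] by (simp flip: norm_power)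

text \<open>
  At \<open>x = y p\<^sup>k\<close>, the two families below are the limits of the theta quotients and of the functions
  \<open>J\<close>, divided by \<open>(-1) powi (k + 1) * q powi (- tri k)\<close> and a power of \<open>x\<close>; the powers of \<open>x\<close> and \<open>q\<close> match up
  because the three degrees add up to \<open>h + 1\<close>.
\<close>

definition twist_weight :: "nat \<Rightarrow> nat \<Rightarrow> complex \<Rightarrow> int \<Rightarrow> complex" where
  "twist_weight h d y k = (if y ^ d = 1 \<and> int h dvd k * int d then - of_nat (h - d) / of_nat d else 1)"

definition sector :: "nat \<Rightarrow> nat \<Rightarrow> nat \<Rightarrow> complex \<Rightarrow> int \<Rightarrow> complex" where
  "sector h l l' y k =
     (if int h dvd k - (int l + int l') div 2 then y powi (- ((int l - int l') div 2)) else 0)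
   - (if int h dvd k + (int l - int l') div 2 then y powi ((int l + int l') div 2) else 0)"

context nome
begin

text \<open>x -> q / x swaps the two products, so 1 / x differs from x by one shift.\<close>

lemma theta_inverse:
  assumes "x \<noteq> 0"
  shows "theta (1 / x) q = - theta x q / x"
proof -
  have "theta (q * (1 / x)) q = theta x q"
    using assms q_nonzero by (simp add: theta_def mult_ac)
  then show ?thesis
    using theta_shift[of "1 / x"] assms by (simp add: field_simps)
qed

lemma theta_power_isCont: "x \<noteq> 0 \<Longrightarrow> isCont (\<lambda>x. theta (x ^ n) q) x"
  using theta_powi_isCont[of 1 x "int n"] by simp

lemma theta_power_deriv:
  assumes "x \<noteq> 0" "x ^ n = q powi m"
  shows "((\<lambda>x. theta (x ^ n) q) has_field_derivative
           of_nat n / x * (-1) powi (m + 1) * q powi (- tri m)) (at x)"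
  using theta_powi_deriv[of x 1 "int n" m] assms by simp

lemma theta_power_meromorphic: "(\<lambda>x. theta (x ^ n) q) meromorphic_on - {0}"
proof -
  have "(\<lambda>x. theta (1 * x powi int n) q) analytic_on {x}" if "x \<noteq> 0" for x
    using that by (intro theta_powi_analytic) auto
  then show ?thesis
    by (subst meromorphic_on_meromorphic_at) (auto intro: analytic_on_imp_meromorphic_on)
qed

lemma theta_quotient_lim_ex:
  assumes "x\<^sub>0 \<noteq> 0" "d > 0" "theta (x\<^sub>0 ^ d) q = 0 \<Longrightarrow> theta (x\<^sub>0 ^ n) q = 0"
  shows "\<exists>L. (\<lambda>x. theta (x ^ n) q / theta (x ^ d) q) \<midarrow>x\<^sub>0\<rightarrow> L"
proof (cases "theta (x\<^sub>0 ^ d) q = 0")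
  case False
  then show ?thesis
    using tendsto_divide[OF theta_power_isCont[OF assms(1), unfolded isCont_def]
        theta_power_isCont[OF assms(1), unfolded isCont_def]] by blast
next
  case True
  with assms have "theta (x\<^sub>0 ^ n) q = 0" by simp
  then obtain m m' where m: "x\<^sub>0 ^ n = q powi m" "x\<^sub>0 ^ d = q powi m'"
    using True assms(1) theta_eq_0_iff[of "x\<^sub>0 ^ n"] theta_eq_0_iff[of "x\<^sub>0 ^ d"] by auto
  show ?thesis
    using lhopital_complex_simple[OF theta_power_deriv[OF assms(1) m(1)]
        theta_power_deriv[OF assms(1) m(2)] \<open>theta (x\<^sub>0 ^ n) q = 0\<close> True _ refl] assms q_nonzero
    by auto
qed

text \<open>Since x0^(h-d) = q^k / x0^d, k shifts and one inversion express the numerator through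
  the denominator. If both vanish, the same relation holds for the leading coefficients, except that
  the numerator is differentiated as a power with exponent h - d where the inversion would have -d;
  this is the extra ratio -(h-d)/d.\<close>

lemma theta_quotient_lim:
  assumes "x\<^sub>0 \<noteq> 0" "x\<^sub>0 ^ h = q powi k" "0 < d" "d < h"
  shows "(\<lambda>x. theta (x ^ (h - d)) q / theta (x ^ d) q) \<midarrow>x\<^sub>0\<rightarrow>
    (-1) powi (k + 1) * q powi (- tri k) * x\<^sub>0 powi (int d * (k - 1)) *
    (if \<exists>m. x\<^sub>0 ^ d = q powi m then - of_nat (h - d) / of_nat d else 1)"
proof -
  have split: "x\<^sub>0 ^ h = x\<^sub>0 ^ (h - d) * x\<^sub>0 ^ d"
    using assms by (simp flip: power_add)
  have "x\<^sub>0 powi (int d * (k - 1)) = (x\<^sub>0 ^ d) powi (k - 1)"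
    by (simp add: power_int_power)
  show ?thesis
  proof (cases "\<exists>m. x\<^sub>0 ^ d = q powi m")
    case True
    then obtain m where m: "x\<^sub>0 ^ d = q powi m" ..
    have m': "x\<^sub>0 ^ (h - d) = q powi (k - m)"
      using split m assms q_nonzero by (simp add: power_int_diff field_simps)
    have zero: "theta (x\<^sub>0 ^ (h - d)) q = 0" "theta (x\<^sub>0 ^ d) q = 0"
      using m m' by (simp_all add: theta_q_powi)
    have exps: "q powi (- tri (k - m)) = q powi (- tri k) * q powi (m * (k - 1)) * q powi (- tri m)"
      using q_nonzero by (simp add: tri_diff flip: power_int_add)
    have signs: "(-1::complex) powi (k - m + 1) = - ((-1) powi (k + 1) * (-1) powi (m + 1))"
      by (simp add: power_int_add power_int_diff divide_simps)
    have "of_nat (h - d) / x\<^sub>0 * (-1) powi (k - m + 1) * q powi (- tri (k - m)) /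
        (of_nat d / x\<^sub>0 * (-1) powi (m + 1) * q powi (- tri m)) =
        (-1) powi (k + 1) * q powi (- tri k) * x\<^sub>0 powi (int d * (k - 1)) *
        (- of_nat (h - d) / of_nat d)"
      unfolding signs exps \<open>x\<^sub>0 powi (int d * (k - 1)) = _\<close> m
      using assms q_nonzero by (simp add: divide_simps power_int_mult) (simp add: algebra_simps)
    from lhopital_complex_simple[OF theta_power_deriv[OF assms(1) m'] theta_power_deriv[OF assms(1) m]
        zero _ this] show ?thesis
      using True assms q_nonzero by simp
  next
    case False
    then have nz: "theta (x\<^sub>0 ^ d) q \<noteq> 0"
      using assms(1) theta_eq_0_iff by simp
    have "x\<^sub>0 ^ (h - d) = q powi k * (1 / x\<^sub>0 ^ d)"
      using split assms by (simp add: field_simps)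
    then have "theta (x\<^sub>0 ^ (h - d)) q =
        (-1) powi k * q powi (- tri k) * (1 / x\<^sub>0 ^ d) powi (- k) * theta (1 / x\<^sub>0 ^ d) q"
      using theta_shift_powi[of "1 / x\<^sub>0 ^ d" k] assms(1) by simp
    also have "theta (1 / x\<^sub>0 ^ d) q = - theta (x\<^sub>0 ^ d) q / x\<^sub>0 ^ d"
      using assms(1) by (intro theta_inverse) simp
    also have "(1 / x\<^sub>0 ^ d) powi (- k) = (x\<^sub>0 ^ d) powi (k - 1) * x\<^sub>0 ^ d"
      using assms(1) by (simp add: power_int_minus power_int_divide_distrib power_int_diff)
    finally have "theta (x\<^sub>0 ^ (h - d)) q / theta (x\<^sub>0 ^ d) q =
        (-1) powi (k + 1) * q powi (- tri k) * x\<^sub>0 powi (int d * (k - 1))"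
      unfolding \<open>x\<^sub>0 powi (int d * (k - 1)) = _\<close>
      using nz assms(1) by (simp add: power_int_add)
    moreover have "(\<lambda>x. theta (x ^ (h - d)) q / theta (x ^ d) q) \<midarrow>x\<^sub>0\<rightarrow>
        theta (x\<^sub>0 ^ (h - d)) q / theta (x\<^sub>0 ^ d) q"
      using theta_power_isCont[OF assms(1)] nz unfolding isCont_def by (intro tendsto_divide)
    ultimately show ?thesis
      using False by simp
  qed
qed

end

text \<open>With \<open>p\<close> the solutions of x^h = q^k become y p^k, y a root of unity. Two
  further nomes occur: p itself, and q^h, which is the nome of the denominators of
  \<open>JJ\<close>.\<close>

locale nome_root = nome +
  fixes h :: nat and p :: complex
  assumes h_pos: "h > 0" and p_root: "p ^ h = q"
begin

sublocale p: nome p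
proof
  show "p \<noteq> 0" using p_root q_nonzero h_pos by auto
  show "norm p < 1"
  proof -
    have "norm p ^ h < 1" using norm_q p_root by (metis norm_power)
    then show ?thesis by (metis not_less one_le_power)
  qed
qed

sublocale Q: nome "q ^ h"
  using q_nonzero norm_q h_pos by unfold_locales (auto simp: norm_power power_less_one_iff)

lemma p_powi: "p powi (int h * n) = q powi n"
  using p_root by (simp add: power_int_mult)

lemma Q_powi: "(q ^ h) powi n = q powi (int h * n)"
  by (simp add: power_int_power)

text \<open>Moduli separate the two conditions: |y| = 1, so |p|^(k d) = |p|^(h m) fixes the
  exponent, and what is left is y^d = 1.\<close>

lemma power_in_q_powers_iff:
  assumes "y ^ h = 1" "x\<^sub>0 = y * p powi k"
  shows "(\<exists>m. x\<^sub>0 ^ d = q powi m) \<longleftrightarrow> y ^ d = 1 \<and> int h dvd k * int d"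
proof -
  have x0: "x\<^sub>0 ^ d = y ^ d * p powi (k * int d)"
    using assms by (simp add: power_mult_distrib power_int_power')
  have "y \<noteq> 0" using assms h_pos by (metis power_0_left neq0_conv zero_neq_one)
  show ?thesis
  proof
    assume "\<exists>m. x\<^sub>0 ^ d = q powi m"
    then obtain m where m: "y ^ d * p powi (k * int d) = p powi (int h * m)"
      using x0 p_powi by metis
    have "norm (y ^ d * p powi (k * int d)) = norm (p powi (int h * m))"
      using m by simp
    then have "norm p powi (k * int d) = norm p powi (int h * m)"
      using root_of_unity_norm[OF assms(1) h_pos] by (simp add: norm_mult norm_power norm_power_int)
    then have eq: "k * int d = int h * m"
      using p.norm_powi_inj by simp
    with m p.q_nonzero show "y ^ d = 1 \<and> int h dvd k * int d"
      by simp
  next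
    assume *: "y ^ d = 1 \<and> int h dvd k * int d"
    then obtain m where "k * int d = int h * m" by (elim conjE dvdE)
    with * show "\<exists>m. x\<^sub>0 ^ d = q powi m"
      by (intro exI[of _ m]) (simp add: x0 p_powi)
  qed
qed

lemma theta_factor_of_nat:
  assumes "d < h"
  shows "theta_factor h (of_nat d) x q = (if 2 * d = h then 1 else theta (x ^ (h - d)) q / theta (x ^ d) q)"
proof -
  have "of_nat d = (of_nat h / 2 :: rat) \<longleftrightarrow> of_nat (2 * d) = (of_nat h :: rat)"
    by (simp add: field_simps)
  also have "\<dots> \<longleftrightarrow> 2 * d = h"
    by (rule of_nat_eq_iff)
  finally have half: "of_nat d = (of_nat h / 2 :: rat) \<longleftrightarrow> 2 * d = h" .
  have "\<lfloor>of_nat h - of_nat d :: rat\<rfloor> = \<lfloor>of_nat (h - d) :: rat\<rfloor>"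
    using assms by (subst of_nat_diff) auto
  then have "\<lfloor>of_nat h - of_nat d :: rat\<rfloor> = int (h - d)"
    by (simp only: floor_of_nat)
  then show ?thesis
    unfolding theta_factor_def half floor_of_nat by (simp only: power_int_of_nat)
qed

text \<open>The squares cancel in (h-d)^2 - d^2 = h^2 - 2 h d, and likewise in the exponents of q.
  Both exponents are therefore linear in d, and a product of factors depends only on the sum of the
  degrees.\<close>

lemma theta_factor_shift:
  assumes "x \<noteq> 0" "d < h"
  shows "theta_factor h (of_nat d) (q * x) q =
    (-1) powi int h * q powi (int d * (int h - 1) - tri (int h)) *
    x powi (2 * int h * int d - int h * int h) * theta_factor h (of_nat d) x q"
proof (cases "2 * d = h")
  \<comment> \<open>The factor is the constant 1 here, so the sign and both powers in the formula
    must be trivial when 2 d = h.\<close>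
  case True
  then have hd: "2 * int d = int h" by simp
  have "2 * (int d * (int h - 1)) = 2 * int d * (int h - 1)"
    by simp
  also have "\<dots> = 2 * tri (int h)"
    unfolding hd two_tri ..
  finally have "int d * (int h - 1) - tri (int h) = 0"
    by simp
  with True show ?thesis
    using assms by (auto simp: theta_factor_of_nat minus_one_powi_even)
next
  case False
  have *: "theta ((q * x) ^ n) q =
      (-1) powi int n * q powi (- tri (int n)) * x powi (- (int n * int n)) * theta (x ^ n) q" for n
  proof -
    have "theta ((q * x) ^ n) q = theta (q powi int n * x ^ n) q"
      by (simp add: power_mult_distrib)
    also have "\<dots> = (-1) powi int n * q powi (- tri (int n)) * (x ^ n) powi (- int n) * theta (x ^ n) q"
      using assms by (intro theta_shift_powi) simp
    also have "(x ^ n) powi (- int n) = x powi (- (int n * int n))"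
      by (simp only: power_int_power mult_minus_right)
    finally show ?thesis .
  qed
  have hd: "int (h - d) = int h - int d" using assms by simp
  have "(-1::complex) powi int (h - d) = (-1) powi int h * (-1) powi int d"
    unfolding hd by (simp add: power_int_diff divide_simps)
  moreover have "q powi (- tri (int (h - d))) = q powi (int d * (int h - 1) - tri (int h)) * q powi (- tri (int d))"
    unfolding hd tri_diff using q_nonzero by (simp flip: power_int_add)
  moreover have "x powi (- (int (h - d) * int (h - d))) =
      x powi (2 * int h * int d - int h * int h) * x powi (- (int d * int d))"
  proof -
    have "- (int (h - d) * int (h - d)) = 2 * int h * int d - int h * int h + - (int d * int d)"
      unfolding hd by (simp add: algebra_simps)
    then show ?thesis
      using power_int_add[of x "2 * int h * int d - int h * int h" "- (int d * int d)"] assms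
      by (simp only: simp_thms)
  qed
  ultimately show ?thesis
    using False assms q_nonzero by (simp add: theta_factor_of_nat *)
qed

lemma theta_factor_lim:
  assumes "y ^ h = 1" "x\<^sub>0 = y * p powi k" "0 < d" "d < h"
  shows "(\<lambda>x. theta_factor h (of_nat d) x q) \<midarrow>x\<^sub>0\<rightarrow>
    (-1) powi (k + 1) * q powi (- tri k) * x\<^sub>0 powi (int d * (k - 1)) * twist_weight h d y k"
proof -
  have "y \<noteq> 0" using assms h_pos by (metis power_0_left neq0_conv zero_neq_one)
  have x0: "x\<^sub>0 \<noteq> 0" "x\<^sub>0 ^ h = q powi k"
    using assms p.q_nonzero \<open>y \<noteq> 0\<close>
    by (simp_all add: power_mult_distrib power_int_power' p_powi mult.commute[of k])
  show ?thesis
  proof (cases "2 * d = h")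
    case False
    with theta_quotient_lim[OF x0 assms(3,4)] show ?thesis
      using assms power_in_q_powers_iff[OF assms(1,2), of d]
      by (simp add: theta_factor_of_nat twist_weight_def)
  next
    \<comment> \<open>The constant 1 still obeys the general formula: y^d is 1 or -1, the powers of
      q and x0 combine to (y^d)^(k-1), and the weight -(h-d)/d = -1 for y^d = 1 and even k corrects
      the sign.\<close>
    case True
    have "(y ^ d)\<^sup>2 = 1"
      using assms True by (simp add: power_mult[symmetric] mult.commute)
    then have yd: "y ^ d = 1 \<or> y ^ d = -1"
      by (simp add: power2_eq_1_iff)
    have "x\<^sub>0 powi (int d * (k - 1)) = (y ^ d) powi (k - 1) * p powi (k * (int d * (k - 1)))"
      using assms by (simp add: power_int_mult_distrib power_int_power flip: power_int_mult)
    also have "k * (int d * (k - 1)) = int d * (2 * tri k)"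
      unfolding two_tri by (simp add: mult_ac)
    also have "\<dots> = int h * tri k"
      using True by auto
    also have "p powi (int h * tri k) = q powi tri k"
      by (rule p_powi)
    finally have "q powi (- tri k) * x\<^sub>0 powi (int d * (k - 1)) = (y ^ d) powi (k - 1)"
      using q_nonzero by (simp add: power_int_minus)
    moreover have "(-1) powi (k + 1) * (y ^ d) powi (k - 1) * twist_weight h d y k = 1"
    proof -
      have "int h dvd k * int d \<longleftrightarrow> even k"
      proof -
        have "int h = int d * 2" using True by simp
        then show ?thesis using assms by (simp add: mult.commute[of k])
      qed
      moreover have "h - d = d" using True by simp
      ultimately have tw: "twist_weight h d y k = (if y ^ d = 1 \<and> even k then -1 else 1)"
        using assms by (auto simp: twist_weight_def)
      show ?thesis
        using yd by (cases "even k") (auto simp: tw minus_one_powi_even minus_one_powi_odd)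
    qed
    ultimately have "(-1) powi (k + 1) * q powi (- tri k) * x\<^sub>0 powi (int d * (k - 1)) *
        twist_weight h d y k = 1"
      by (metis mult.assoc)
    then show ?thesis
      using True assms by (simp add: theta_factor_of_nat)
  qed
qed

end

section \<open>Values of the functions J\<close>

locale JJ_term = nome_root +
  fixes l l' :: nat
  assumes l_bounds: "0 < l" "l < h" and l'_pos: "0 < l'"
    and parity: "even (int l - int l')"
    and exponent: "4 * int h dvd (int l)\<^sup>2 - (int l')\<^sup>2"
begin

definition "a = (int l + int l') div 2"
definition "b = (int l - int l') div 2"
definition "e = ((int l)\<^sup>2 - (int l')\<^sup>2) div (4 * int h)"

lemma two_a: "2 * a = int l + int l'" and two_b: "2 * b = int l - int l'"
  using parity by (auto simp: a_def b_def)

lemma a_plus_b: "a + b = int l" and a_minus_b: "a - b = int l'"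
  using two_a two_b by auto

text \<open>The divisibility hypothesis in the form used below: it turns the powers of p that arise
  in the limits into powers of q.\<close>

lemma a_mult_b: "a * b = int h * e"
proof -
  have "4 * (a * b) = (a + b)\<^sup>2 - (a - b)\<^sup>2"
    by (simp add: power2_eq_square algebra_simps)
  also have "\<dots> = 4 * int h * e"
    unfolding a_plus_b a_minus_b e_def using exponent by simp
  finally show ?thesis by simp
qed

definition D\<^sub>1 :: "complex \<Rightarrow> complex" where
  "D\<^sub>1 x = theta (q powi a * x powi (- int h)) (q ^ h)"

definition D\<^sub>2 :: "complex \<Rightarrow> complex" where
  "D\<^sub>2 x = theta (q powi b * x powi int h) (q ^ h)"

lemma JJ_eq:
  "JJ h l l' x q = q powi e * x ^ (l' - 1) * (theta (x ^ h) q * theta (q ^ l) (q ^ h) / (D\<^sub>1 x * D\<^sub>2 x))"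
  by (simp add: JJ_def a_def b_def e_def D\<^sub>1_def D\<^sub>2_def)

lemma theta_l_nonzero: "theta (q ^ l) (q ^ h) \<noteq> 0"
proof
  assume "theta (q ^ l) (q ^ h) = 0"
  then obtain m where "q powi int l = q powi (int h * m)"
    using Q.theta_eq_0_iff[of "q ^ l"] q_nonzero by (auto simp: Q_powi)
  then have "int l = int h * m"
    by (simp only: powi_inj)
  then have "int h dvd int l" by simp
  then show False
    using l_bounds by (auto dest: zdvd_imp_le)
qed

lemma D\<^sub>1_eq_0_imp:
  assumes "x \<noteq> 0" "D\<^sub>1 x = 0"
  shows "\<exists>m. x ^ h = q powi (a + int h * m)"
proof -
  obtain m where "q powi a * x powi (- int h) = q powi (int h * m)"
    using assms Q.theta_eq_0_iff[of "q powi a * x powi (- int h)"] q_nonzero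
    by (auto simp: D\<^sub>1_def Q_powi)
  then have "x ^ h = q powi (a + int h * (- m))"
    using assms q_nonzero by (simp add: power_int_minus power_int_diff field_simps)
  then show ?thesis ..
qed

lemma D\<^sub>2_eq_0_imp:
  assumes "x \<noteq> 0" "D\<^sub>2 x = 0"
  shows "\<exists>m. x ^ h = q powi (- b + int h * m)"
proof -
  obtain m where "q powi b * x powi int h = q powi (int h * m)"
    using assms Q.theta_eq_0_iff[of "q powi b * x powi int h"] q_nonzero
    by (auto simp: D\<^sub>2_def Q_powi)
  then have "x ^ h = q powi (- b + int h * m)"
    using assms q_nonzero by (simp add: power_int_minus power_int_diff field_simps)
  then show ?thesis ..
qed

lemma isCont_D: "x \<noteq> 0 \<Longrightarrow> isCont D\<^sub>1 x" "x \<noteq> 0 \<Longrightarrow> isCont D\<^sub>2 x"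
  unfolding D\<^sub>1_def D\<^sub>2_def using q_nonzero by (intro Q.theta_powi_isCont; simp)+

lemma JJ_meromorphic: "(\<lambda>x. JJ h l l' x q) meromorphic_on - {0}"
proof -
  have "D\<^sub>1 analytic_on {x}" "D\<^sub>2 analytic_on {x}" if "x \<noteq> 0" for x
    unfolding D\<^sub>1_def D\<^sub>2_def using that q_nonzero by (intro Q.theta_powi_analytic; simp)+
  then have "D\<^sub>1 meromorphic_on - {0}" "D\<^sub>2 meromorphic_on - {0}"
    by (subst meromorphic_on_meromorphic_at; auto intro: analytic_on_imp_meromorphic_on)+
  then show ?thesis
    unfolding JJ_eq by (intro meromorphic_intros theta_power_meromorphic)
qed

lemma JJ_tendsto_regular:
  assumes "x\<^sub>0 \<noteq> 0" "D\<^sub>1 x\<^sub>0 \<noteq> 0" "D\<^sub>2 x\<^sub>0 \<noteq> 0"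
  shows "(\<lambda>x. JJ h l l' x q) \<midarrow>x\<^sub>0\<rightarrow> JJ h l l' x\<^sub>0 q"
  unfolding JJ_eq using assms isCont_D[OF assms(1)] theta_power_isCont[OF assms(1), of h]
  unfolding isCont_def
  by (intro tendsto_mult tendsto_divide tendsto_power tendsto_const tendsto_ident_at) auto

lemma JJ_lim_ex:
  assumes "x\<^sub>0 \<noteq> 0" "\<And>k. x\<^sub>0 ^ h \<noteq> q powi k"
  shows "\<exists>L. (\<lambda>x. JJ h l l' x q) \<midarrow>x\<^sub>0\<rightarrow> L"
  using JJ_tendsto_regular[OF assms(1)] D\<^sub>1_eq_0_imp[OF assms(1)] D\<^sub>2_eq_0_imp[OF assms(1)] assms(2)
  by blast

text \<open>The multiplier is independent of l and l', so any linear combination of these functions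
  inherits it: the power of x contributes q^(l'-1), and the two denominators contribute q^(h -
  (a-b)) with a - b = l'.\<close>

lemma JJ_shift:
  assumes "x \<noteq> 0"
  shows "JJ h l l' (q * x) q =
    (-1) powi int h * q powi (int h - 1 - tri (int h)) * x powi (- (int h * (int h - 2))) * JJ h l l' x q"
proof -
  have T: "theta ((q * x) ^ h) q =
      (-1) powi int h * q powi (- tri (int h)) * x powi (- (int h * int h)) * theta (x ^ h) q"
  proof -
    have "theta ((q * x) ^ h) q = theta (q powi int h * x ^ h) q"
      by (simp add: power_mult_distrib)
    also have "\<dots> = (-1) powi int h * q powi (- tri (int h)) * (x ^ h) powi (- int h) * theta (x ^ h) q"
      using assms by (intro theta_shift_powi) simp
    also have "(x ^ h) powi (- int h) = x powi (- (int h * int h))"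
      by (simp only: power_int_power mult_minus_right)
    finally show ?thesis .
  qed
  have d1: "D\<^sub>1 (q * x) = - (q powi (a - int h) * x powi (- int h)) * D\<^sub>1 x"
  proof -
    have "q powi a * (q * x) powi (- int h) = (q ^ h) powi (-1) * (q powi a * x powi (- int h))"
      by (simp add: power_mult_distrib power_int_mult_distrib power_int_minus)
    then have "D\<^sub>1 (q * x) = (-1) powi (-1) * (q ^ h) powi (- tri (-1)) *
        (q powi a * x powi (- int h)) powi (- (-1)) * D\<^sub>1 x"
      unfolding D\<^sub>1_def using assms q_nonzero by (simp only:) (intro Q.theta_shift_powi, simp)
    also have "(q ^ h) powi (- tri (-1)) = q powi (- int h)"
      by (simp add: tri_def power_int_minus)
    finally show ?thesis
      using q_nonzero by (simp add: power_int_diff power_int_minus divide_simps)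
  qed
  have d2: "D\<^sub>2 (q * x) = - (q powi (- b) * x powi (- int h)) * D\<^sub>2 x"
  proof -
    have "q powi b * (q * x) powi int h = (q ^ h) powi 1 * (q powi b * x powi int h)"
      by (simp add: power_mult_distrib)
    then have "D\<^sub>2 (q * x) = (-1) powi 1 * (q ^ h) powi (- tri 1) *
        (q powi b * x powi int h) powi (- 1) * D\<^sub>2 x"
      unfolding D\<^sub>2_def using assms q_nonzero by (simp only:) (intro Q.theta_shift_powi, simp)
    then show ?thesis
      by (simp add: tri_def power_int_mult_distrib power_int_minus)
  qed
  have "(q * x) ^ (l' - 1) = q powi (int l' - 1) * x ^ (l' - 1)"
    using l'_pos by (simp add: power_int_mult_distrib of_nat_diff flip: power_int_of_nat)
  moreover have "int h - 1 - tri (int h) = (int l' - 1) + (- tri (int h)) - ((a - int h) + (- b))"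
    using a_minus_b by simp
  then have "q powi (int h - 1 - tri (int h)) =
      q powi (int l' - 1) * q powi (- tri (int h)) / (q powi (a - int h) * q powi (- b))"
    using q_nonzero by (simp only: power_int_add power_int_diff simp_thms)
  moreover have "- (int h * (int h - 2)) = - (int h * int h) - (- int h + - int h)"
    by (simp add: algebra_simps)
  then have "x powi (- (int h * (int h - 2))) =
      x powi (- (int h * int h)) / (x powi (- int h) * x powi (- int h))"
    using assms by (simp only: power_int_add power_int_diff simp_thms)
  ultimately show ?thesis
    unfolding JJ_eq T d1 d2 by (simp only:) (simp add: divide_simps)
qed

text \<open>Trades the power of y that occurs in \<open>sector\<close> for powers of x0 and p, which
  can be compared with the exponents in \<open>JJ\<close>.\<close>

lemma root_exponent:
  assumes "x\<^sub>0 = y * p powi k" "y \<noteq> 0"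
  shows "x\<^sub>0 powi (k - 1) * y powi n = x\<^sub>0 powi (k + n - 1) * p powi (- (k * n))"
proof -
  have "x\<^sub>0 \<noteq> 0" using assms p.q_nonzero by simp
  have "y = x\<^sub>0 * p powi (- k)"
    using assms p.q_nonzero by (simp add: power_int_minus)
  then have "y powi n = x\<^sub>0 powi n * p powi (- (k * n))"
    by (simp only: power_int_mult_distrib power_int_mult[symmetric] mult_minus_left)
  moreover have "x\<^sub>0 powi (k - 1) * x\<^sub>0 powi n = x\<^sub>0 powi (k + n - 1)"
    using \<open>x\<^sub>0 \<noteq> 0\<close> by (simp add: algebra_simps flip: power_int_add)
  ultimately show ?thesis by (simp add: mult.assoc[symmetric])
qed

text \<open>The simple zero of \<open>D\<^sub>1\<close> cancels that of theta(x^h, q). Because a + b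
  = l, the other denominator is theta(q^(h m) q^l, q^h), a shift of the constant theta(q^l, q^h) in
  the numerator of \<open>JJ\<close>. So all theta values disappear and only powers have to be
  compared.\<close>

lemma JJ_lim_D\<^sub>1:
  assumes "y \<noteq> 0" "x\<^sub>0 = y * p powi k" "x\<^sub>0 ^ h = q powi k" "k = a + int h * m"
  shows "(\<lambda>x. JJ h l l' x q) \<midarrow>x\<^sub>0\<rightarrow>
    (-1) powi (k + 1) * q powi (- tri k) * x\<^sub>0 powi (k - 1) * y powi (- b)"
proof -
  have x0: "x\<^sub>0 \<noteq> 0" using assms p.q_nonzero by simp
  have val1: "q powi a * x\<^sub>0 powi (- int h) = (q ^ h) powi (- m)"
    using assms(3) q_nonzero unfolding power_int_minus power_int_of_nat
    by (simp add: assms(4) power_int_add Q_powi divide_simps)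
  have val2: "q powi b * x\<^sub>0 powi int h = (q ^ h) powi m * q ^ l"
  proof -
    have "b + k = int h * m + int l"
      using a_plus_b assms(4) by simp
    then have "q powi b * q powi k = q powi (int h * m) * q powi int l"
      using q_nonzero by (simp only: power_int_add[symmetric] simp_thms)
    then show ?thesis by (simp add: assms(3) Q_powi)
  qed
  have D2: "D\<^sub>2 x\<^sub>0 = (-1) powi m * (q ^ h) powi (- tri m) * (q ^ l) powi (- m) * theta (q ^ l) (q ^ h)"
    unfolding D\<^sub>2_def val2 using q_nonzero by (intro Q.theta_shift_powi) simp
  then have D2_nz: "D\<^sub>2 x\<^sub>0 \<noteq> 0"
    using theta_l_nonzero q_nonzero by simp
  have dT: "((\<lambda>x. theta (x ^ h) q) has_field_derivative
      of_nat h / x\<^sub>0 * (-1) powi (k + 1) * q powi (- tri k)) (at x\<^sub>0)"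
    by (rule theta_power_deriv[OF x0 assms(3)])
  have dD: "(D\<^sub>1 has_field_derivative
      of_int (- int h) / x\<^sub>0 * (-1) powi (- m + 1) * (q ^ h) powi (- tri (- m))) (at x\<^sub>0)"
    unfolding D\<^sub>1_def by (rule Q.theta_powi_deriv[OF x0 val1])
  have "(-1::complex) powi (- m + 1) = - ((-1) powi m)"
    by (simp add: power_int_diff divide_simps)
  then have "of_nat h / x\<^sub>0 * (-1) powi (k + 1) * q powi (- tri k) /
      (of_int (- int h) / x\<^sub>0 * (-1) powi (- m + 1) * (q ^ h) powi (- tri (- m))) =
      (-1) powi (k + 1) * q powi (- tri k) * (-1) powi m * (q ^ h) powi tri (- m)"
    using h_pos x0 q_nonzero by (simp only:) (simp add: power_int_minus divide_simps)
  from lhopital_complex_simple[OF dT dD _ _ _ this]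
  have quot: "(\<lambda>x. theta (x ^ h) q / D\<^sub>1 x) \<midarrow>x\<^sub>0\<rightarrow>
      (-1) powi (k + 1) * q powi (- tri k) * (-1) powi m * (q ^ h) powi tri (- m)"
    using h_pos x0 q_nonzero assms(3) val1 by (simp add: theta_q_powi D\<^sub>1_def Q.theta_q_powi)
  have "(\<lambda>x. q powi e * x ^ (l' - 1) * ((theta (x ^ h) q / D\<^sub>1 x) * (theta (q ^ l) (q ^ h) / D\<^sub>2 x)))
      \<midarrow>x\<^sub>0\<rightarrow> q powi e * x\<^sub>0 ^ (l' - 1) *
        (((-1) powi (k + 1) * q powi (- tri k) * (-1) powi m * (q ^ h) powi tri (- m)) *
         (theta (q ^ l) (q ^ h) / D\<^sub>2 x\<^sub>0))" (is "_ \<midarrow>_\<rightarrow> ?L")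
    using isCont_D(2)[OF x0] D2_nz quot unfolding isCont_def
    by (intro tendsto_mult tendsto_divide tendsto_power tendsto_const tendsto_ident_at)
  moreover have "?L = (-1) powi (k + 1) * q powi (- tri k) * x\<^sub>0 powi (k - 1) * y powi (- b)"
  proof -
    have r: "x\<^sub>0 powi (k - 1) * y powi (- b) = x\<^sub>0 powi (k - b - 1) * p powi (k * b)"
      using root_exponent[OF assms(2,1), of "- b"] by simp
    have "k - b - 1 = int (l' - 1) + int h * m"
      using l'_pos a_minus_b assms(4) by (simp add: of_nat_diff)
    then have "x\<^sub>0 powi (k - b - 1) = x\<^sub>0 ^ (l' - 1) * q powi (k * m)"
      using x0 assms(3) by (simp only: power_int_add power_int_mult power_int_of_nat simp_thms)
    moreover have "k * b = int h * (e + m * b)"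
      using a_mult_b assms(4) by (simp add: algebra_simps)
    then have "p powi (k * b) = q powi (e + m * b)"
      by (simp only: p_powi)
    \<comment> \<open>Uses tri(-m) + tri(m) = m^2 and a + b = l.\<close>
    moreover have "k * m + (e + m * b) = e + int h * tri (- m) + int h * tri m + int l * m"
      unfolding tri_minus using a_plus_b by (simp add: assms(4) algebra_simps flip: a_plus_b)
    then have "q powi (k * m) * q powi (e + m * b) =
        q powi e * (q ^ h) powi tri (- m) * (q ^ h) powi tri m * (q ^ l) powi m"
      using q_nonzero unfolding Q_powi power_int_power
      by (simp only: power_int_add[symmetric] simp_thms)
    ultimately have "x\<^sub>0 powi (k - 1) * y powi (- b) = x\<^sub>0 ^ (l' - 1) *
        (q powi e * (q ^ h) powi tri (- m) * (q ^ h) powi tri m * (q ^ l) powi m)"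
      unfolding r by (simp only: mult.assoc)
    moreover have "theta (q ^ l) (q ^ h) / D\<^sub>2 x\<^sub>0 = (-1) powi m * (q ^ h) powi tri m * (q ^ l) powi m"
      unfolding D2 using theta_l_nonzero q_nonzero by (simp add: power_int_minus divide_simps)
    ultimately show ?thesis by (simp add: mult_ac)
  qed
  ultimately show ?thesis
    unfolding JJ_eq by (simp add: mult_ac)
qed

text \<open>The mirror case. The minus sign arises because x enters \<open>D\<^sub>2\<close> with
  exponent h and \<open>D\<^sub>1\<close> with exponent -h.\<close>

lemma JJ_lim_D\<^sub>2:
  assumes "y \<noteq> 0" "x\<^sub>0 = y * p powi k" "x\<^sub>0 ^ h = q powi k" "k = - b + int h * m"
  shows "(\<lambda>x. JJ h l l' x q) \<midarrow>x\<^sub>0\<rightarrow>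
    - ((-1) powi (k + 1) * q powi (- tri k) * x\<^sub>0 powi (k - 1) * y powi a)"
proof -
  have x0: "x\<^sub>0 \<noteq> 0" using assms p.q_nonzero by simp
  have val2: "q powi b * x\<^sub>0 powi int h = (q ^ h) powi m"
    using assms(3) q_nonzero unfolding power_int_of_nat
    by (simp add: assms(4) power_int_diff power_int_minus power_int_add Q_powi divide_simps mult.commute)
  have val1: "q powi a * x\<^sub>0 powi (- int h) = (q ^ h) powi (- m) * q ^ l"
  proof -
    have "a + - k = - (int h * m) + int l"
      using a_plus_b assms(4) by simp
    then have "q powi a * q powi (- k) = q powi (- (int h * m)) * q powi int l"
      using q_nonzero by (simp only: power_int_add[symmetric] simp_thms)
    moreover have "x\<^sub>0 powi (- int h) = q powi (- k)"
      using assms(3) unfolding power_int_minus power_int_of_nat by simp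
    ultimately show ?thesis by (simp add: Q_powi)
  qed
  have D1: "D\<^sub>1 x\<^sub>0 = (-1) powi (- m) * (q ^ h) powi (- tri (- m)) * (q ^ l) powi (- (- m)) * theta (q ^ l) (q ^ h)"
    unfolding D\<^sub>1_def val1 using q_nonzero by (intro Q.theta_shift_powi) simp
  then have D1_nz: "D\<^sub>1 x\<^sub>0 \<noteq> 0"
    using theta_l_nonzero q_nonzero by simp
  have dT: "((\<lambda>x. theta (x ^ h) q) has_field_derivative
      of_nat h / x\<^sub>0 * (-1) powi (k + 1) * q powi (- tri k)) (at x\<^sub>0)"
    by (rule theta_power_deriv[OF x0 assms(3)])
  have dD: "(D\<^sub>2 has_field_derivative
      of_int (int h) / x\<^sub>0 * (-1) powi (m + 1) * (q ^ h) powi (- tri m)) (at x\<^sub>0)"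
    unfolding D\<^sub>2_def by (rule Q.theta_powi_deriv[OF x0 val2])
  have "of_nat h / x\<^sub>0 * (-1) powi (k + 1) * q powi (- tri k) /
      (of_int (int h) / x\<^sub>0 * (-1) powi (m + 1) * (q ^ h) powi (- tri m)) =
      - ((-1) powi (k + 1) * q powi (- tri k) * (-1) powi m * (q ^ h) powi tri m)"
    using h_pos x0 q_nonzero by (simp add: power_int_add power_int_minus divide_simps)
  from lhopital_complex_simple[OF dT dD _ _ _ this]
  have quot: "(\<lambda>x. theta (x ^ h) q / D\<^sub>2 x) \<midarrow>x\<^sub>0\<rightarrow>
      - ((-1) powi (k + 1) * q powi (- tri k) * (-1) powi m * (q ^ h) powi tri m)"
    using h_pos x0 q_nonzero assms(3) val2 by (simp add: theta_q_powi D\<^sub>2_def Q.theta_q_powi)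
  have "(\<lambda>x. q powi e * x ^ (l' - 1) * ((theta (x ^ h) q / D\<^sub>2 x) * (theta (q ^ l) (q ^ h) / D\<^sub>1 x)))
      \<midarrow>x\<^sub>0\<rightarrow> q powi e * x\<^sub>0 ^ (l' - 1) *
        (- ((-1) powi (k + 1) * q powi (- tri k) * (-1) powi m * (q ^ h) powi tri m) *
         (theta (q ^ l) (q ^ h) / D\<^sub>1 x\<^sub>0))" (is "_ \<midarrow>_\<rightarrow> ?L")
    using isCont_D(1)[OF x0] D1_nz quot unfolding isCont_def
    by (intro tendsto_mult tendsto_divide tendsto_power tendsto_const tendsto_ident_at)
  moreover have "?L = - ((-1) powi (k + 1) * q powi (- tri k) * x\<^sub>0 powi (k - 1) * y powi a)"
  proof -
    have r: "x\<^sub>0 powi (k - 1) * y powi a = x\<^sub>0 powi (k + a - 1) * p powi (- (k * a))"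
      by (rule root_exponent[OF assms(2,1)])
    have "k + a - 1 = int (l' - 1) + int h * m"
      using l'_pos a_minus_b assms(4) by (simp add: of_nat_diff)
    then have "x\<^sub>0 powi (k + a - 1) = x\<^sub>0 ^ (l' - 1) * q powi (k * m)"
      using x0 assms(3) by (simp only: power_int_add power_int_mult power_int_of_nat simp_thms)
    moreover have "- (k * a) = int h * (e - m * a)"
    proof -
      have "- (k * a) = (b - int h * m) * a"
        by (simp add: assms(4) algebra_simps)
      also have "\<dots> = int h * (e - m * a)"
        using a_mult_b by (simp add: algebra_simps)
      finally show ?thesis .
    qed
    then have "p powi (- (k * a)) = q powi (e - m * a)"
      by (simp only: p_powi)
    moreover have "k * m + (e - m * a) = e + int h * tri (- m) + int h * tri m + int l * (- m)"
      unfolding tri_minus using a_plus_b by (simp add: assms(4) algebra_simps flip: a_plus_b)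
    then have "q powi (k * m) * q powi (e - m * a) =
        q powi e * (q ^ h) powi tri (- m) * (q ^ h) powi tri m * (q ^ l) powi (- m)"
      using q_nonzero unfolding Q_powi power_int_power
      by (simp only: power_int_add[symmetric] simp_thms)
    ultimately have "x\<^sub>0 powi (k - 1) * y powi a = x\<^sub>0 ^ (l' - 1) *
        (q powi e * (q ^ h) powi tri (- m) * (q ^ h) powi tri m * (q ^ l) powi (- m))"
      unfolding r by (simp only: mult.assoc)
    moreover have "theta (q ^ l) (q ^ h) / D\<^sub>1 x\<^sub>0 = (-1) powi m * (q ^ h) powi tri (- m) * (q ^ l) powi (- m)"
      unfolding D1 using theta_l_nonzero q_nonzero by (simp add: power_int_minus divide_simps)
    ultimately show ?thesis by (simp add: mult_ac)
  qed
  ultimately show ?thesis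
    unfolding JJ_eq by (simp add: mult_ac)
qed

lemma JJ_lim:
  assumes "y ^ h = 1" "x\<^sub>0 = y * p powi k"
  shows "(\<lambda>x. JJ h l l' x q) \<midarrow>x\<^sub>0\<rightarrow>
    (-1) powi (k + 1) * q powi (- tri k) * x\<^sub>0 powi (k - 1) * sector h l l' y k"
proof -
  have y: "y \<noteq> 0" using assms h_pos by (metis power_0_left neq0_conv zero_neq_one)
  have x0: "x\<^sub>0 \<noteq> 0" "x\<^sub>0 ^ h = q powi k"
    using assms p.q_nonzero y
    by (simp_all add: power_mult_distrib power_int_power' p_powi mult.commute[of k])
  \<comment> \<open>The difference of the two numbers is l, which lies strictly between 0 and h;
    hence at most one term of \<open>sector\<close> is nonzero and at most one denominator
    vanishes.\<close>
  have both: "\<not> (int h dvd k - a \<and> int h dvd k + b)"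
  proof
    assume "int h dvd k - a \<and> int h dvd k + b"
    then have "int h dvd (k + b) - (k - a)" by (blast intro: dvd_diff)
    also have "(k + b) - (k - a) = int l" using a_plus_b by simp
    finally have "int h dvd int l" .
    then show False using l_bounds by (auto dest: zdvd_imp_le)
  qed
  consider "int h dvd k - a" | "int h dvd k + b" | "\<not> int h dvd k - a" "\<not> int h dvd k + b"
    by blast
  then show ?thesis
  proof cases
    case 1
    then obtain m where "k - a = int h * m" by (elim dvdE)
    then have "k = a + int h * m" by simp
    from JJ_lim_D\<^sub>1[OF y assms(2) x0(2) this] show ?thesis
      using 1 both by (simp add: sector_def flip: a_def b_def)
  next
    case 2
    then obtain m where "k + b = int h * m" by (elim dvdE)
    then have "k = - b + int h * m" by simp
    from JJ_lim_D\<^sub>2[OF y assms(2) x0(2) this] show ?thesis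
      using 2 both by (simp add: sector_def flip: a_def b_def)
  next
    \<comment> \<open>Both denominators are nonzero here, while the numerator theta(x^h, q)
      vanishes.\<close>
    case 3
    have "D\<^sub>1 x\<^sub>0 \<noteq> 0"
    proof
      assume "D\<^sub>1 x\<^sub>0 = 0"
      then obtain m where "k = a + int h * m"
        using D\<^sub>1_eq_0_imp[OF x0(1)] x0(2) powi_inj by auto
      with 3 show False by simp
    qed
    moreover have "D\<^sub>2 x\<^sub>0 \<noteq> 0"
    proof
      assume "D\<^sub>2 x\<^sub>0 = 0"
      then obtain m where "k = - b + int h * m"
        using D\<^sub>2_eq_0_imp[OF x0(1)] x0(2) powi_inj by auto
      with 3 show False by simp
    qed
    ultimately have "(\<lambda>x. JJ h l l' x q) \<midarrow>x\<^sub>0\<rightarrow> JJ h l l' x\<^sub>0 q"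
      by (rule JJ_tendsto_regular[OF x0(1)])
    moreover have "JJ h l l' x\<^sub>0 q = 0"
      by (simp add: JJ_eq x0(2) theta_q_powi)
    ultimately show ?thesis
      using 3 by (simp add: sector_def flip: a_def b_def)
  qed
qed

end

section \<open>Reduction to an identity for roots of unity\<close>

context nome_root
begin

lemma twisted_point:
  assumes "x\<^sub>0 \<noteq> 0" "x\<^sub>0 ^ h = q powi k"
  obtains y where "y ^ h = 1" "x\<^sub>0 = y * p powi k"
proof
  have "(p powi (- k)) ^ h = p powi (int h * (- k))"
    by (simp only: power_int_power' mult.commute)
  then show "(x\<^sub>0 * p powi (- k)) ^ h = 1"
    using assms(2) q_nonzero by (simp only: power_mult_distrib p_powi) (simp add: power_int_minus)
  show "x\<^sub>0 = x\<^sub>0 * p powi (- k) * p powi k"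
    using p.q_nonzero by (simp add: power_int_minus)
qed

text \<open>The analytic part of the argument with the left-hand side kept abstract, to be used for
  one factor (type A) and for three (the others). The comparison of coefficients enters only through
  \<open>W\<close>.\<close>

lemma mero_eq_on_JJ_sum:
  fixes N :: "nat \<Rightarrow> nat \<Rightarrow> int"
  assumes terms: "\<And>l l'. (l, l') \<in> S \<Longrightarrow> JJ_term q h p l l'"
    and mero: "F meromorphic_on - {0}"
    and lim_ex: "\<And>x\<^sub>0. x\<^sub>0 \<noteq> 0 \<Longrightarrow> (\<And>k. x\<^sub>0 ^ h \<noteq> q powi k) \<Longrightarrow> \<exists>L. F \<midarrow>x\<^sub>0\<rightarrow> L"
    and shift: "\<And>x. x \<noteq> 0 \<Longrightarrow> F (q * x) =
      (-1) powi int h * q powi (int h - 1 - tri (int h)) * x powi (- (int h * (int h - 2))) * F x"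
    and lim: "\<And>x\<^sub>0 y k. y ^ h = 1 \<Longrightarrow> x\<^sub>0 = y * p powi k \<Longrightarrow>
      F \<midarrow>x\<^sub>0\<rightarrow> (-1) powi (k + 1) * q powi (- tri k) * x\<^sub>0 powi (k - 1) * W y k"
    and W: "\<And>y k. y ^ h = 1 \<Longrightarrow> W y k = (\<Sum>(l, l')\<in>S. of_int (N l l') * sector h l l' y k)"
  shows "mero_eq_on (- {0}) F (\<lambda>x. \<Sum>(l, l')\<in>S. of_int (N l l') * JJ h l l' x q)"
proof -
  define R where "R x = (\<Sum>(l, l')\<in>S. of_int (N l l') * JJ h l l' x q)" for x
  have R_mero: "R meromorphic_on - {0}"
    unfolding R_def case_prod_beta
    by (intro meromorphic_intros JJ_term.JJ_meromorphic[OF terms]) auto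
  have R_shift: "R (q * x) = (-1) powi int h * q powi (int h - 1 - tri (int h)) *
      x powi (- (int h * (int h - 2))) * R x" if "x \<noteq> 0" for x
    unfolding R_def sum_distrib_left
    by (rule sum.cong) (auto simp: JJ_term.JJ_shift[OF terms that])
  have R_lim: "R \<midarrow>x\<^sub>0\<rightarrow> (-1) powi (k + 1) * q powi (- tri k) * x\<^sub>0 powi (k - 1) * W y k"
    if "y ^ h = 1" "x\<^sub>0 = y * p powi k" for x\<^sub>0 y k
  proof -
    have "R \<midarrow>x\<^sub>0\<rightarrow> (\<Sum>(l, l')\<in>S. of_int (N l l') *
        ((-1) powi (k + 1) * q powi (- tri k) * x\<^sub>0 powi (k - 1) * sector h l l' y k))"
      unfolding R_def case_prod_beta
      by (intro tendsto_sum tendsto_mult tendsto_const JJ_term.JJ_lim[OF terms] that) auto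
    also have "(\<Sum>(l, l')\<in>S. of_int (N l l') *
        ((-1) powi (k + 1) * q powi (- tri k) * x\<^sub>0 powi (k - 1) * sector h l l' y k)) =
        (-1) powi (k + 1) * q powi (- tri k) * x\<^sub>0 powi (k - 1) * W y k"
      unfolding W[OF that(1)] sum_distrib_left by (rule sum.cong) auto
    finally show ?thesis .
  qed
  have R_lim_ex: "\<exists>L. R \<midarrow>x\<^sub>0\<rightarrow> L" if "x\<^sub>0 \<noteq> 0" "\<And>k. x\<^sub>0 ^ h \<noteq> q powi k" for x\<^sub>0
  proof -
    have "\<exists>L. \<forall>z\<in>S. (\<lambda>x. JJ h (fst z) (snd z) x q) \<midarrow>x\<^sub>0\<rightarrow> L z"
      using JJ_term.JJ_lim_ex[OF terms that] by (intro bchoice) auto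
    then obtain L where "\<And>z. z \<in> S \<Longrightarrow> (\<lambda>x. JJ h (fst z) (snd z) x q) \<midarrow>x\<^sub>0\<rightarrow> L z"
      by auto
    then have "R \<midarrow>x\<^sub>0\<rightarrow> (\<Sum>z\<in>S. of_int (N (fst z) (snd z)) * L z)"
      unfolding R_def case_prod_beta by (intro tendsto_sum tendsto_mult tendsto_const)
    then show ?thesis ..
  qed
  have "\<forall>\<^sub>F x in at z. F x - R x = 0" if "z \<noteq> 0" for z
  proof (rule meromorphic_eq_0I[OF h_pos _ _ _ _ that])
    show "(\<lambda>x. F x - R x) meromorphic_on - {0}"
      by (intro meromorphic_intros mero R_mero)
    show zero: "(\<lambda>x. F x - R x) \<midarrow>x\<^sub>0\<rightarrow> 0" if x0: "x\<^sub>0 \<noteq> 0" "x\<^sub>0 ^ h = q powi k" for x\<^sub>0 k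
    proof -
      obtain y where y: "y ^ h = 1" "x\<^sub>0 = y * p powi k"
        using twisted_point[OF x0] .
      show ?thesis
        using tendsto_diff[OF lim[OF y] R_lim[OF y]] by simp
    qed
    show "\<exists>L. (\<lambda>x. F x - R x) \<midarrow>x\<^sub>0\<rightarrow> L" if x0: "x\<^sub>0 \<noteq> 0" for x\<^sub>0
    proof (cases "\<exists>k. x\<^sub>0 ^ h = q powi k")
      case True
      then show ?thesis using zero[OF x0] by blast
    next
      case False
      then obtain L L' where "F \<midarrow>x\<^sub>0\<rightarrow> L" "R \<midarrow>x\<^sub>0\<rightarrow> L'"
        using lim_ex[OF x0] R_lim_ex[OF x0] by blast
      then show ?thesis by (blast intro: tendsto_diff)
    qed
    show "F (q * x) - R (q * x) = (-1) powi int h * q powi (int h - 1 - tri (int h)) *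
        x powi (- (int h * (int h - 2))) * (F x - R x)" if "x \<noteq> 0" for x
      unfolding shift[OF that] R_shift[OF that] by (simp only: right_diff_distrib)
  qed
  then show ?thesis
    unfolding mero_eq_on_def R_def[symmetric]
    using mero R_mero by (simp add: eventually_cosparse_open_eq open_Compl)
qed

section \<open>Limits away from the points x^h = q^k, and the two shapes of the left-hand
  side\<close>

lemma theta_factor_meromorphic:
  "d < h \<Longrightarrow> (\<lambda>x. theta_factor h (of_nat d) x q) meromorphic_on - {0}"
  by (cases "2 * d = h") (auto simp: theta_factor_of_nat intro!: meromorphic_intros theta_power_meromorphic)

text \<open>If d divides h and x^d is a power of q, so is x^h: such a factor has its poles only at
  the points treated separately.\<close>

lemma theta_power_nonzero_of_dvd:
  assumes "x\<^sub>0 \<noteq> 0" "\<And>k. x\<^sub>0 ^ h \<noteq> q powi k" "d dvd h"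
  shows "theta (x\<^sub>0 ^ d) q \<noteq> 0"
proof
  assume "theta (x\<^sub>0 ^ d) q = 0"
  then obtain m where "x\<^sub>0 ^ d = q powi m"
    using theta_eq_0_iff[of "x\<^sub>0 ^ d"] assms by auto
  moreover obtain c where "h = d * c" using assms(3) by (elim dvdE)
  ultimately have "x\<^sub>0 ^ h = q powi (m * int c)"
    by (simp add: power_mult power_int_power')
  with assms(2) show False by blast
qed

lemma theta_factor_lim_ex:
  assumes "x\<^sub>0 \<noteq> 0" "\<And>k. x\<^sub>0 ^ h \<noteq> q powi k" "d dvd h" "0 < d" "d < h"
  shows "\<exists>L. (\<lambda>x. theta_factor h (of_nat d) x q) \<midarrow>x\<^sub>0\<rightarrow> L"
  using theta_quotient_lim_ex[OF assms(1,4), of "h - d"] theta_power_nonzero_of_dvd[OF assms(1-3)]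
    tendsto_const[of "1::complex" "at x\<^sub>0"] assms(5)
  by (cases "2 * d = h") (auto simp: theta_factor_of_nat)

lemma theta_factor_mult_lim_ex:
  assumes "x\<^sub>0 \<noteq> 0" "\<And>k. x\<^sub>0 ^ h \<noteq> q powi k"
    and "d dvd h" "0 < d" "d < h" "e dvd h" "0 < e" "e < h"
  shows "\<exists>L. (\<lambda>x. theta_factor h (of_nat d) x q * theta_factor h (of_nat e) x q) \<midarrow>x\<^sub>0\<rightarrow> L"
  using theta_factor_lim_ex[OF assms(1-5)] theta_factor_lim_ex[OF assms(1,2,6-8)]
  by (fast intro: tendsto_mult)

text \<open>If \<open>d\<close> does not divide \<open>h\<close>, the poles of one factor are cancelled by the numerator of another.\<close>

lemma theta_factor_pair_lim_ex:
  assumes "x\<^sub>0 \<noteq> 0" "\<And>k. x\<^sub>0 ^ h \<noteq> q powi k" "e dvd h" "0 < e" "e < h" "2 * e \<noteq> h"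
    and "d dvd h - e" "0 < d" "d < h" "2 * d \<noteq> h"
  shows "\<exists>L. (\<lambda>x. theta_factor h (of_nat d) x q * theta_factor h (of_nat e) x q) \<midarrow>x\<^sub>0\<rightarrow> L"
proof -
  obtain L where L: "(\<lambda>x. theta (x ^ (h - d)) q / theta (x ^ e) q) \<midarrow>x\<^sub>0\<rightarrow> L"
    using theta_quotient_lim_ex[OF assms(1,4), of "h - d"] theta_power_nonzero_of_dvd[OF assms(1-3)]
    by blast
  have "theta (x\<^sub>0 ^ (h - e)) q = 0" if "theta (x\<^sub>0 ^ d) q = 0"
  proof -
    obtain m where m: "x\<^sub>0 ^ d = q powi m"
      using theta_eq_0_iff[of "x\<^sub>0 ^ d"] assms(1) \<open>theta (x\<^sub>0 ^ d) q = 0\<close> by auto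
    obtain c where "h - e = d * c" using assms(7) by (elim dvdE)
    with m have "x\<^sub>0 ^ (h - e) = q powi (m * int c)"
      by (simp add: power_mult power_int_power')
    then show ?thesis by (simp add: theta_q_powi)
  qed
  then obtain L' where L': "(\<lambda>x. theta (x ^ (h - e)) q / theta (x ^ d) q) \<midarrow>x\<^sub>0\<rightarrow> L'"
    using theta_quotient_lim_ex[OF assms(1,8), of "h - e"] by blast
  have "(\<lambda>x. theta_factor h (of_nat d) x q * theta_factor h (of_nat e) x q) =
      (\<lambda>x. (theta (x ^ (h - d)) q / theta (x ^ e) q) * (theta (x ^ (h - e)) q / theta (x ^ d) q))"
    using assms by (simp add: theta_factor_of_nat mult_ac)
  then show ?thesis
    using tendsto_mult[OF L L'] by auto
qed

text \<open>The first two factors are kept together in \<open>lim_ex\<close> because their poles may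
  cancel only in the product. The third degree is h/2 in all applications and divides h, so that
  factor has limits by itself.\<close>

lemma mero_eq_on_three_factors:
  fixes N :: "nat \<Rightarrow> nat \<Rightarrow> int" and d\<^sub>1 d\<^sub>2 d\<^sub>3 :: nat
  assumes terms: "\<And>l l'. (l, l') \<in> S \<Longrightarrow> JJ_term q h p l l'"
    and d: "d\<^sub>1 + d\<^sub>2 + d\<^sub>3 = h + 1" "0 < d\<^sub>1" "d\<^sub>1 < h" "0 < d\<^sub>2" "d\<^sub>2 < h" "0 < d\<^sub>3" "d\<^sub>3 < h"
    and "even h"
    and lim_ex: "\<And>x\<^sub>0. x\<^sub>0 \<noteq> 0 \<Longrightarrow> (\<And>k. x\<^sub>0 ^ h \<noteq> q powi k) \<Longrightarrow>
      \<exists>L. (\<lambda>x. theta_factor h (of_nat d\<^sub>1) x q * theta_factor h (of_nat d\<^sub>2) x q) \<midarrow>x\<^sub>0\<rightarrow> L"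
    and "d\<^sub>3 dvd h"
    and W: "\<And>y k. y ^ h = 1 \<Longrightarrow>
      twist_weight h d\<^sub>1 y k * twist_weight h d\<^sub>2 y k * twist_weight h d\<^sub>3 y k =
      (\<Sum>(l, l')\<in>S. of_int (N l l') * sector h l l' y k)"
  shows "mero_eq_on (- {0})
    (\<lambda>x. \<Prod>d\<leftarrow>[of_nat d\<^sub>1, of_nat d\<^sub>2, of_nat d\<^sub>3]. theta_factor h d x q)
    (\<lambda>x. \<Sum>(l, l')\<in>S. of_int (N l l') * JJ h l l' x q)"
proof -
  have list: "(\<Prod>d\<leftarrow>[of_nat d\<^sub>1, of_nat d\<^sub>2, of_nat d\<^sub>3]. theta_factor h d x q) =
      theta_factor h (of_nat d\<^sub>1) x q * theta_factor h (of_nat d\<^sub>2) x q * theta_factor h (of_nat d\<^sub>3) x q" for x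
    by simp
  have d_int: "int d\<^sub>1 = int h + 1 - int d\<^sub>2 - int d\<^sub>3"
    using d(1) by linarith
  show ?thesis
    unfolding list
  proof (rule mero_eq_on_JJ_sum[OF terms])
    show "(\<lambda>x. theta_factor h (of_nat d\<^sub>1) x q * theta_factor h (of_nat d\<^sub>2) x q *
        theta_factor h (of_nat d\<^sub>3) x q) meromorphic_on - {0}"
      using d by (intro meromorphic_intros theta_factor_meromorphic)
  next
    fix x\<^sub>0 assume x0: "x\<^sub>0 \<noteq> 0" "\<And>k. x\<^sub>0 ^ h \<noteq> q powi k"
    show "\<exists>L. (\<lambda>x. theta_factor h (of_nat d\<^sub>1) x q * theta_factor h (of_nat d\<^sub>2) x q *
        theta_factor h (of_nat d\<^sub>3) x q) \<midarrow>x\<^sub>0\<rightarrow> L"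
      using lim_ex[OF x0] theta_factor_lim_ex[OF x0 \<open>d\<^sub>3 dvd h\<close> d(6,7)] by (fast intro: tendsto_mult)
  next
    fix x :: complex assume x: "x \<noteq> 0"
    have s: "(-1::complex) powi int h = 1"
      using \<open>even h\<close> by (simp add: minus_one_powi_even)
    \<comment> \<open>This is where the sum h + 1 of the degrees enters: (h+1)(h-1) - 3 tri(h) = h -
      1 - tri(h), as 2 tri(h) = h(h-1).\<close>
    have "int h - 1 - tri (int h) = (int d\<^sub>1 * (int h - 1) - tri (int h)) +
        (int d\<^sub>2 * (int h - 1) - tri (int h)) + (int d\<^sub>3 * (int h - 1) - tri (int h))"
      using two_tri[of "int h"] unfolding d_int by (simp add: algebra_simps)
    then have qe: "q powi (int h - 1 - tri (int h)) = q powi (int d\<^sub>1 * (int h - 1) - tri (int h)) *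
        q powi (int d\<^sub>2 * (int h - 1) - tri (int h)) * q powi (int d\<^sub>3 * (int h - 1) - tri (int h))"
      using q_nonzero by (simp only: power_int_add[symmetric] simp_thms)
    have "- (int h * (int h - 2)) = (2 * int h * int d\<^sub>1 - int h * int h) +
        (2 * int h * int d\<^sub>2 - int h * int h) + (2 * int h * int d\<^sub>3 - int h * int h)"
      unfolding d_int by (simp add: algebra_simps)
    then have xe: "x powi (- (int h * (int h - 2))) = x powi (2 * int h * int d\<^sub>1 - int h * int h) *
        x powi (2 * int h * int d\<^sub>2 - int h * int h) * x powi (2 * int h * int d\<^sub>3 - int h * int h)"
      using x by (simp only: power_int_add[symmetric] simp_thms)
    show "theta_factor h (of_nat d\<^sub>1) (q * x) q * theta_factor h (of_nat d\<^sub>2) (q * x) q *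
        theta_factor h (of_nat d\<^sub>3) (q * x) q =
        (-1) powi int h * q powi (int h - 1 - tri (int h)) * x powi (- (int h * (int h - 2))) *
        (theta_factor h (of_nat d\<^sub>1) x q * theta_factor h (of_nat d\<^sub>2) x q * theta_factor h (of_nat d\<^sub>3) x q)"
      unfolding theta_factor_shift[OF x d(3)] theta_factor_shift[OF x d(5)] theta_factor_shift[OF x d(7)]
        s qe xe by (simp only: mult_ac mult_1_left)
  next
    fix x\<^sub>0 y k assume y: "y ^ h = 1" "x\<^sub>0 = y * p powi k"
    define B where "B = (-1) powi (k + 1) * q powi (- tri k)"
    have y0: "y \<noteq> 0" using y h_pos by (metis power_0_left neq0_conv zero_neq_one)
    have x0: "x\<^sub>0 \<noteq> 0" "x\<^sub>0 ^ h = q powi k"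
      using y p.q_nonzero y0
      by (simp_all add: power_mult_distrib power_int_power' p_powi mult.commute[of k])
    \<comment> \<open>Of the three copies of \<open>B\<close> one has to survive. The degrees give
      x0^((h+1)(k-1)), and x0^(h(k-1)) = q^(k(k-1)) = q^(2 tri k) cancels the other two.\<close>
    have "int d\<^sub>1 * (k - 1) + int d\<^sub>2 * (k - 1) + int d\<^sub>3 * (k - 1) = int h * (k - 1) + (k - 1)"
      unfolding d_int by (simp add: algebra_simps)
    then have "x\<^sub>0 powi (int d\<^sub>1 * (k - 1)) * x\<^sub>0 powi (int d\<^sub>2 * (k - 1)) * x\<^sub>0 powi (int d\<^sub>3 * (k - 1)) =
        x\<^sub>0 powi (int h * (k - 1)) * x\<^sub>0 powi (k - 1)"
      using x0(1) by (simp only: power_int_add[symmetric] simp_thms)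
    also have "x\<^sub>0 powi (int h * (k - 1)) = q powi (2 * tri k)"
      unfolding power_int_mult[of x\<^sub>0] power_int_of_nat x0(2) two_tri by (simp only: power_int_mult)
    finally have xs: "x\<^sub>0 powi (int d\<^sub>1 * (k - 1)) * x\<^sub>0 powi (int d\<^sub>2 * (k - 1)) *
        x\<^sub>0 powi (int d\<^sub>3 * (k - 1)) = q powi (2 * tri k) * x\<^sub>0 powi (k - 1)" .
    have "- tri k + - tri k + 2 * tri k = 0" by simp
    then have "q powi (- tri k) * q powi (- tri k) * q powi (2 * tri k) = 1"
      using q_nonzero by (simp only: power_int_add[symmetric] simp_thms power_int_0_right)
    then have BB: "B * B * q powi (2 * tri k) = 1"
      unfolding B_def by (simp add: mult_ac)
    have "(B * x\<^sub>0 powi (int d\<^sub>1 * (k - 1)) * twist_weight h d\<^sub>1 y k) *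
        (B * x\<^sub>0 powi (int d\<^sub>2 * (k - 1)) * twist_weight h d\<^sub>2 y k) *
        (B * x\<^sub>0 powi (int d\<^sub>3 * (k - 1)) * twist_weight h d\<^sub>3 y k) =
        B * B * B * (x\<^sub>0 powi (int d\<^sub>1 * (k - 1)) * x\<^sub>0 powi (int d\<^sub>2 * (k - 1)) *
        x\<^sub>0 powi (int d\<^sub>3 * (k - 1))) *
        (twist_weight h d\<^sub>1 y k * twist_weight h d\<^sub>2 y k * twist_weight h d\<^sub>3 y k)"
      by (simp only: mult_ac)
    also have "\<dots> = (B * B * q powi (2 * tri k)) * (B * x\<^sub>0 powi (k - 1)) *
        (twist_weight h d\<^sub>1 y k * twist_weight h d\<^sub>2 y k * twist_weight h d\<^sub>3 y k)"
      unfolding xs by (simp only: mult_ac)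
    finally have eq: "(B * x\<^sub>0 powi (int d\<^sub>1 * (k - 1)) * twist_weight h d\<^sub>1 y k) *
        (B * x\<^sub>0 powi (int d\<^sub>2 * (k - 1)) * twist_weight h d\<^sub>2 y k) *
        (B * x\<^sub>0 powi (int d\<^sub>3 * (k - 1)) * twist_weight h d\<^sub>3 y k) =
        B * x\<^sub>0 powi (k - 1) *
        (twist_weight h d\<^sub>1 y k * twist_weight h d\<^sub>2 y k * twist_weight h d\<^sub>3 y k)"
      unfolding BB by simp
    show "(\<lambda>x. theta_factor h (of_nat d\<^sub>1) x q * theta_factor h (of_nat d\<^sub>2) x q *
        theta_factor h (of_nat d\<^sub>3) x q) \<midarrow>x\<^sub>0\<rightarrow>
        (-1) powi (k + 1) * q powi (- tri k) * x\<^sub>0 powi (k - 1) *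
        (twist_weight h d\<^sub>1 y k * twist_weight h d\<^sub>2 y k * twist_weight h d\<^sub>3 y k)"
      unfolding B_def[symmetric] eq[symmetric]
      unfolding B_def using y d by (intro tendsto_mult theta_factor_lim)
  next
    show "twist_weight h d\<^sub>1 y k * twist_weight h d\<^sub>2 y k * twist_weight h d\<^sub>3 y k =
        (\<Sum>(l, l')\<in>S. of_int (N l l') * sector h l l' y k)" if "y ^ h = 1" for y k
      by (rule W[OF that])
  qed
qed

text \<open>Type A is separate because h may be odd, so that h/2 is not a natural number. For d = 1
  the exponents of \<open>theta_factor_shift\<close> and \<open>theta_factor_lim\<close> already
  have the required form.\<close>

lemma mero_eq_on_one_factor:
  fixes N :: "nat \<Rightarrow> nat \<Rightarrow> int"
  assumes terms: "\<And>l l'. (l, l') \<in> S \<Longrightarrow> JJ_term q h p l l'"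
    and "1 < h"
    and W: "\<And>y k. y ^ h = 1 \<Longrightarrow>
      twist_weight h 1 y k = (\<Sum>(l, l')\<in>S. of_int (N l l') * sector h l l' y k)"
  shows "mero_eq_on (- {0})
    (\<lambda>x. theta_factor h 1 x q)
    (\<lambda>x. \<Sum>(l, l')\<in>S. of_int (N l l') * JJ h l l' x q)"
proof -
  have one: "theta_factor h 1 = theta_factor h (of_nat 1)"
    by simp
  show ?thesis
    unfolding one
  proof (rule mero_eq_on_JJ_sum[OF terms])
    show "(\<lambda>x. theta_factor h (of_nat 1) x q) meromorphic_on - {0}"
      by (rule theta_factor_meromorphic) fact
    show "\<exists>L. (\<lambda>x. theta_factor h (of_nat 1) x q) \<midarrow>x\<^sub>0\<rightarrow> L"
      if "x\<^sub>0 \<noteq> 0" "\<And>k. x\<^sub>0 ^ h \<noteq> q powi k" for x\<^sub>0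
      using theta_factor_lim_ex[OF that, of 1] \<open>1 < h\<close> by simp
    have "int 1 * (int h - 1) - tri (int h) = int h - 1 - tri (int h)"
      "2 * int h * int 1 - int h * int h = - (int h * (int h - 2))"
      by (simp_all add: algebra_simps)
    then show "theta_factor h (of_nat 1) (q * x) q = (-1) powi int h * q powi (int h - 1 - tri (int h)) *
        x powi (- (int h * (int h - 2))) * theta_factor h (of_nat 1) x q" if "x \<noteq> 0" for x
      using theta_factor_shift[OF that \<open>1 < h\<close>] by (simp only:)
    show "(\<lambda>x. theta_factor h (of_nat 1) x q) \<midarrow>x\<^sub>0\<rightarrow>
        (-1) powi (k + 1) * q powi (- tri k) * x\<^sub>0 powi (k - 1) * twist_weight h 1 y k"
      if "y ^ h = 1" "x\<^sub>0 = y * p powi k" for x\<^sub>0 y k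
      using theta_factor_lim[OF that, of 1] \<open>1 < h\<close> by simp
    show "twist_weight h 1 y k = (\<Sum>(l, l')\<in>S. of_int (N l l') * sector h l l' y k)"
      if "y ^ h = 1" for y k
      by (rule W[OF that])
  qed
qed

end

section \<open>Sums over sectors and the exceptional types\<close>

lemma sum_chi:
  fixes f :: "nat \<Rightarrow> 'a::comm_ring_1"
  assumes "finite A" "set is \<subseteq> A"
  shows "(\<Sum>l\<in>A. of_int (chi is l) * f l) = (\<Sum>i\<leftarrow>is. f i)"
  using assms(2)
proof (induction "is")
  case Nil
  then show ?case by (simp add: chi_def)
next
  case (Cons i "is")
  have "(\<Sum>l\<in>A. of_int (chi (i # is) l) * f l) =
      (\<Sum>l\<in>A. (if l = i then f l else 0) + of_int (chi is l) * f l)"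
    by (rule sum.cong) (auto simp: chi_def algebra_simps)
  also have "\<dots> = f i + (\<Sum>l\<in>A. of_int (chi is l) * f l)"
    using Cons.prems assms(1) by (simp add: sum.distrib)
  finally show ?case
    using Cons by simp
qed

lemma sum_sesq:
  fixes f :: "nat \<Rightarrow> nat \<Rightarrow> 'a::comm_ring_1"
  assumes "finite A" "set is \<subseteq> A" "set js \<subseteq> A"
  shows "(\<Sum>l\<in>A. \<Sum>l'\<in>A. of_int (sesq (chi is) (chi js) l l') * f l l') =
    (\<Sum>i\<leftarrow>is. \<Sum>j\<leftarrow>js. f i j)"
proof -
  have "(\<Sum>l\<in>A. \<Sum>l'\<in>A. of_int (sesq (chi is) (chi js) l l') * f l l') =
      (\<Sum>l\<in>A. of_int (chi is l) * (\<Sum>l'\<in>A. of_int (chi js l') * f l l'))"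
    by (simp add: sesq_def sum_distrib_left mult_ac)
  also have "\<dots> = (\<Sum>i\<leftarrow>is. \<Sum>j\<leftarrow>js. f i j)"
    by (simp add: sum_chi[OF assms(1,3)] sum_chi[OF assms(1,2)])
  finally show ?thesis .
qed

lemmas sum_abs2 = sum_sesq[of A "is" "is" f for A "is" f, folded abs2_def]

text \<open>\<open>JJ_term\<close> is available only for nonzero coefficients, whereas the
  sesquilinear forms expand over the full square of indices.\<close>

lemma sum_nonzero_coefficients:
  fixes N :: "nat \<Rightarrow> nat \<Rightarrow> int" and f :: "nat \<Rightarrow> nat \<Rightarrow> complex"
  assumes "finite A"
  shows "(\<Sum>(l, l')\<in>{(l, l'). l \<in> A \<and> l' \<in> A \<and> N l l' \<noteq> 0}. of_int (N l l') * f l l') =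
    (\<Sum>l\<in>A. \<Sum>l'\<in>A. of_int (N l l') * f l l')"
proof -
  have "(\<Sum>(l, l')\<in>{(l, l'). l \<in> A \<and> l' \<in> A \<and> N l l' \<noteq> 0}. of_int (N l l') * f l l') =
      (\<Sum>(l, l')\<in>A \<times> A. of_int (N l l') * f l l')"
    using assms by (intro sum.mono_neutral_left) auto
  then show ?thesis
    by (simp add: sum.cartesian_product)
qed

lemma root_of_unity_powi:
  assumes "y ^ h = 1" "h > 0"
  shows "y powi n = (y::complex) ^ nat (n mod int h)"
proof -
  have "y \<noteq> 0" using assms by (metis power_0_left neq0_conv zero_neq_one)
  have "y powi n = y powi (int h * (n div int h)) * y powi (n mod int h)"
    using power_int_add[of y "int h * (n div int h)" "n mod int h"] \<open>y \<noteq> 0\<close> by simp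
  also have "y powi (int h * (n div int h)) = 1"
    using assms by (simp add: power_int_mult)
  also have "1 * y powi (n mod int h) = y powi (n mod int h)"
    by simp
  also have "\<dots> = y ^ nat (n mod int h)"
    using assms by (simp add: power_int_nonneg_exp)
  finally show ?thesis .
qed

lemma geometric_sum_root_of_unity:
  fixes y :: complex
  assumes "y ^ (d * m) = 1"
  shows "(\<Sum>s<m. y ^ (d * s)) = (if y ^ d = 1 then of_nat m else 0)"
proof -
  have "(\<Sum>s<m. y ^ (d * s)) = (\<Sum>s<m. (y ^ d) ^ s)"
    by (simp add: power_mult)
  also have "\<dots> = (if y ^ d = 1 then of_nat m else 0)"
    using assms by (simp add: sum_gp_strict power_mult)
  finally show ?thesis .
qed

text \<open>Removes the case distinction on y: for h = d m the weight is 1 - m, and the geometric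
  sum of y^d is m or 0 according to whether y^d = 1. The weight becomes a polynomial in y, valid for
  every y with y^h = 1.\<close>

lemma twist_weight_dvd:
  assumes "y ^ h = 1" "h = d * m" "h > 0"
  shows "twist_weight h d y k = (if int m dvd k mod int h then 1 - (\<Sum>s<m. y ^ (d * s)) else 1)"
proof -
  have "int h dvd k * int d \<longleftrightarrow> int m dvd k"
    using assms by (simp add: mult.commute[of k])
  also have "\<dots> \<longleftrightarrow> int m dvd k mod int h"
    using assms(2) by (intro dvd_mod_iff[symmetric]) simp
  finally have "int h dvd k * int d \<longleftrightarrow> int m dvd k mod int h" .
  moreover have "(- of_nat (h - d) / of_nat d :: complex) = 1 - of_nat m"
  proof -
    have "h - d = d * (m - 1)" "m \<ge> 1" "d > 0"
      using assms by (auto simp: diff_mult_distrib2)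
    then show ?thesis by (simp add: of_nat_diff)
  qed
  ultimately show ?thesis
    using geometric_sum_root_of_unity[of y d m] assms(1,2) by (auto simp: twist_weight_def)
qed

lemma dvd_diff_iff_mod: "(c::int) dvd k - a \<longleftrightarrow> k mod c = a mod c"
  by (metis mod_eq_dvd_iff)

lemma dvd_add_iff_mod: "(c::int) dvd k + b \<longleftrightarrow> k mod c = (- b) mod c"
  using dvd_diff_iff_mod[of c k "- b"] by simp

text \<open>Exponents of y are reduced to the range below h, and k enters only through its residue,
  so that both sides can be compared literally.\<close>

lemma sector_root_of_unity:
  assumes "y ^ h = 1" "h > 0"
  shows "sector h l l' y k =
     (if k mod int h = ((int l + int l') div 2) mod int h
      then y ^ nat ((- ((int l - int l') div 2)) mod int h) else 0)
   - (if k mod int h = (- ((int l - int l') div 2)) mod int h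
      then y ^ nat (((int l + int l') div 2) mod int h) else 0)"
  unfolding sector_def root_of_unity_powi[OF assms] dvd_diff_iff_mod dvd_add_iff_mod ..

text \<open>The condition on n makes this a terminating rewrite rule for numeral exponents.\<close>

lemma power_reduce: "y ^ h = (1::complex) \<Longrightarrow> h \<le> n \<Longrightarrow> y ^ n = y ^ (n - h)"
  by (metis le_add_diff_inverse mult_1_left power_add)

lemma nat_mod_cases:
  fixes k :: int
  assumes "h > 0"
  obtains n where "k mod int h = int n" "n \<in> {..<h}"
  using that[of "nat (k mod int h)"] assms by (simp add: nat_less_iff)

lemma twist_identity_E6:
  assumes y: "y ^ 12 = 1"
  shows "twist_weight 12 3 y k * twist_weight 12 4 y k * twist_weight 12 6 y k =
    (\<Sum>l\<in>{1..11}. \<Sum>l'\<in>{1..11}. of_int (ade_N TypeE6 l l') * sector 12 l l' y k)"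
proof -
  have "(12::nat) = 3 * 4" "(12::nat) = 4 * 3" "(12::nat) = 6 * 2"
    by simp_all
  note weights = this[THEN twist_weight_dvd[OF y _ zero_less_numeral], of k]
  have bounds: "set [1, 7::nat] \<subseteq> {1..11}" "set [4, 8::nat] \<subseteq> {1..11}" "set [5, 11::nat] \<subseteq> {1..11}"
    by simp_all
  have sum: "(\<Sum>l\<in>{1..11}. \<Sum>l'\<in>{1..11}. of_int (ade_N TypeE6 l l') * sector 12 l l' y k) =
    (\<Sum>i\<leftarrow>[1,7]. \<Sum>j\<leftarrow>[1,7]. sector 12 i j y k) + (\<Sum>i\<leftarrow>[4,8]. \<Sum>j\<leftarrow>[4,8]. sector 12 i j y k) +
    (\<Sum>i\<leftarrow>[5,11]. \<Sum>j\<leftarrow>[5,11]. sector 12 i j y k)"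
    by (simp only: ade_N.simps of_int_add distrib_right sum.distrib
      sum_abs2[OF finite_atLeastAtMost bounds(1) bounds(1)]
      sum_abs2[OF finite_atLeastAtMost bounds(2) bounds(2)]
      sum_abs2[OF finite_atLeastAtMost bounds(3) bounds(3)])
  obtain n where n: "k mod int 12 = int n" "n \<in> {..<12}"
    by (rule nat_mod_cases[of 12 k]) simp
  then have "n \<in> {11,10,9,8,7,6,5,4,3,2,1,0}"
    by (simp add: lessThan_nat_numeral lessThan_Suc)
  then show ?thesis
    unfolding sum
    unfolding weights sector_root_of_unity[OF y zero_less_numeral] n(1)
    \<comment> \<open>For each residue n all conditions are decided by evaluation. What remains is
      an equality of integer polynomials in y, checked by expanding products and reducing exponents
      with y^12 = 1.\<close>
    by (elim insertE emptyE; hypsubst;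
      simp add: lessThan_nat_numeral lessThan_Suc ring_distribs power_reduce[OF y]
        flip: power_add power_Suc power_Suc2 power2_eq_square)
qed

text \<open>
  Since \<open>4\<close> does not divide \<open>18\<close>, the weight \<open>-7/2\<close> of the degree \<open>4\<close> is an integral polynomial in \<open>y\<close> only
  after multiplication by the weight of the degree \<open>6\<close>.
\<close>

lemma twist_weights_E7:
  assumes y: "y ^ 18 = 1"
  shows "twist_weight 18 4 y k * twist_weight 18 6 y k =
    (if 3 dvd k mod 18 then 1 - (\<Sum>s<3. y ^ (6 * s)) else 1) +
    (if 9 dvd k mod 18 then \<Sum>s<9. y ^ (2 * s) else 0)"
proof -
  \<comment> \<open>gcd(4, 18) = 2, realised by 18 = 4 * 4 + 2.\<close>
  have "y ^ 4 = 1 \<longleftrightarrow> y ^ 2 = 1"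
  proof
    assume "y ^ 4 = 1"
    moreover have "y ^ 18 = (y ^ 4) ^ 4 * y ^ 2"
      by (simp flip: power_mult power_add)
    ultimately show "y ^ 2 = 1"
      using y by simp
  next
    assume "y ^ 2 = 1"
    moreover have "y ^ 4 = (y ^ 2) ^ 2"
      by (simp flip: power_mult)
    ultimately show "y ^ 4 = 1"
      by simp
  qed
  moreover have "18 dvd k * 4 \<longleftrightarrow> 9 dvd k mod 18" "18 dvd k * 6 \<longleftrightarrow> 3 dvd k mod 18"
    by presburger+
  moreover have "3 dvd k mod 18" if "9 dvd k mod 18"
    using dvd_trans[OF _ that, of 3] by simp
  moreover have "y ^ 6 = 1" if "y ^ 2 = 1"
    using that power_mult[of y 2 3] by simp
  moreover have "(\<Sum>s<3. y ^ (6 * s)) = (if y ^ 6 = 1 then of_nat 3 else 0)"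
    by (rule geometric_sum_root_of_unity) (simp add: y)
  moreover have "(\<Sum>s<9. y ^ (2 * s)) = (if y ^ 2 = 1 then of_nat 9 else 0)"
    by (rule geometric_sum_root_of_unity) (simp add: y)
  \<comment> \<open>The conditions for degree 4 imply those for degree 6. The product is then
    (-7/2)(-2) = 7 = -2 + 9, which explains the correction by a sum of nine powers of y^2.\<close>
  ultimately show ?thesis
    by (simp add: twist_weight_def)
qed

lemma twist_identity_E7:
  assumes y: "y ^ 18 = 1"
  shows "twist_weight 18 4 y k * twist_weight 18 6 y k * twist_weight 18 9 y k =
    (\<Sum>l\<in>{1..17}. \<Sum>l'\<in>{1..17}. of_int (ade_N TypeE7 l l') * sector 18 l l' y k)"
proof -
  have "(18::nat) = 9 * 2"
    by simp
  note weight = twist_weight_dvd[OF y this zero_less_numeral, of k]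
  have bounds: "set [1, 17::nat] \<subseteq> {1..17}" "set [5, 13::nat] \<subseteq> {1..17}"
    "set [7, 11::nat] \<subseteq> {1..17}" "set [9::nat] \<subseteq> {1..17}" "set [3, 15::nat] \<subseteq> {1..17}"
    by simp_all
  have sum: "(\<Sum>l\<in>{1..17}. \<Sum>l'\<in>{1..17}. of_int (ade_N TypeE7 l l') * sector 18 l l' y k) =
    (\<Sum>i\<leftarrow>[1,17]. \<Sum>j\<leftarrow>[1,17]. sector 18 i j y k) + (\<Sum>i\<leftarrow>[5,13]. \<Sum>j\<leftarrow>[5,13]. sector 18 i j y k) +
    (\<Sum>i\<leftarrow>[7,11]. \<Sum>j\<leftarrow>[7,11]. sector 18 i j y k) + (\<Sum>i\<leftarrow>[9]. \<Sum>j\<leftarrow>[9]. sector 18 i j y k) +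
    (\<Sum>i\<leftarrow>[3,15]. \<Sum>j\<leftarrow>[9]. sector 18 i j y k) + (\<Sum>i\<leftarrow>[9]. \<Sum>j\<leftarrow>[3,15]. sector 18 i j y k)"
    by (simp only: ade_N.simps of_int_add distrib_right sum.distrib
      sum_abs2[OF finite_atLeastAtMost bounds(1) bounds(1)]
      sum_abs2[OF finite_atLeastAtMost bounds(2) bounds(2)]
      sum_abs2[OF finite_atLeastAtMost bounds(3) bounds(3)]
      sum_abs2[OF finite_atLeastAtMost bounds(4) bounds(4)]
      sum_sesq[OF finite_atLeastAtMost bounds(5) bounds(4)]
      sum_sesq[OF finite_atLeastAtMost bounds(4) bounds(5)])
  obtain n where n: "k mod int 18 = int n" "n \<in> {..<18}"
    by (rule nat_mod_cases[of 18 k]) simp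
  then have "n \<in> {17,16,15,14,13,12,11,10,9,8,7,6,5,4,3,2,1,0}"
    by (simp add: lessThan_nat_numeral lessThan_Suc)
  moreover have "k mod 18 = int n"
    using n(1) by simp
  ultimately show ?thesis
    unfolding sum twist_weights_E7[OF y]
    unfolding weight sector_root_of_unity[OF y zero_less_numeral] n(1)
    by (elim insertE emptyE; hypsubst;
      simp add: lessThan_nat_numeral lessThan_Suc ring_distribs power_reduce[OF y]
        flip: power_add power_Suc power_Suc2 power2_eq_square)
qed

lemma twist_identity_E8:
  assumes y: "y ^ 30 = 1"
  shows "twist_weight 30 6 y k * twist_weight 30 10 y k * twist_weight 30 15 y k =
    (\<Sum>l\<in>{1..29}. \<Sum>l'\<in>{1..29}. of_int (ade_N TypeE8 l l') * sector 30 l l' y k)"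
proof -
  have "(30::nat) = 6 * 5" "(30::nat) = 10 * 3" "(30::nat) = 15 * 2"
    by simp_all
  note weights = this[THEN twist_weight_dvd[OF y _ zero_less_numeral], of k]
  have bounds: "set [1, 11, 19, 29::nat] \<subseteq> {1..29}" "set [7, 13, 17, 23::nat] \<subseteq> {1..29}"
    by simp_all
  have sum: "(\<Sum>l\<in>{1..29}. \<Sum>l'\<in>{1..29}. of_int (ade_N TypeE8 l l') * sector 30 l l' y k) =
    (\<Sum>i\<leftarrow>[1,11,19,29]. \<Sum>j\<leftarrow>[1,11,19,29]. sector 30 i j y k) +
    (\<Sum>i\<leftarrow>[7,13,17,23]. \<Sum>j\<leftarrow>[7,13,17,23]. sector 30 i j y k)"
    by (simp only: ade_N.simps of_int_add distrib_right sum.distrib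
      sum_abs2[OF finite_atLeastAtMost bounds(1) bounds(1)]
      sum_abs2[OF finite_atLeastAtMost bounds(2) bounds(2)])
  obtain n where n: "k mod int 30 = int n" "n \<in> {..<30}"
    by (rule nat_mod_cases[of 30 k]) simp
  then have "n \<in> {29,28,27,26,25,24,23,22,21,20,19,18,17,16,15,14,13,12,11,10,9,8,7,6,5,4,3,2,1,0}"
    by (simp add: lessThan_nat_numeral lessThan_Suc)
  then show ?thesis
    unfolding sum
    unfolding weights sector_root_of_unity[OF y zero_less_numeral] n(1)
    by (elim insertE emptyE; hypsubst;
      simp add: lessThan_nat_numeral lessThan_Suc ring_distribs power_reduce[OF y]
        flip: power_add power_Suc power_Suc2 power2_eq_square)
qed

section \<open>Types A and D\<close>

lemma sum_of_int_sum:
  fixes M :: "'i \<Rightarrow> nat \<Rightarrow> nat \<Rightarrow> int" and f :: "nat \<Rightarrow> nat \<Rightarrow> 'a::comm_ring_1"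
  shows "(\<Sum>l\<in>A. \<Sum>l'\<in>A. of_int (\<Sum>i\<in>I. M i l l') * f l l') =
    (\<Sum>i\<in>I. \<Sum>l\<in>A. \<Sum>l'\<in>A. of_int (M i l l') * f l l')"
proof -
  have "(\<Sum>l\<in>A. \<Sum>l'\<in>A. of_int (\<Sum>i\<in>I. M i l l') * f l l') =
      (\<Sum>l\<in>A. \<Sum>l'\<in>A. \<Sum>i\<in>I. of_int (M i l l') * f l l')"
    by (simp add: sum_distrib_right)
  also have "\<dots> = (\<Sum>l\<in>A. \<Sum>i\<in>I. \<Sum>l'\<in>A. of_int (M i l l') * f l l')"
    by (intro sum.cong refl sum.swap)
  also have "\<dots> = (\<Sum>i\<in>I. \<Sum>l\<in>A. \<Sum>l'\<in>A. of_int (M i l l') * f l l')"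
    by (rule sum.swap)
  finally show ?thesis .
qed

lemma sector_diagonal:
  "sector h l l y k = (if int h dvd k - int l then 1 else 0) - (if int h dvd k then y powi int l else 0)"
  by (simp add: sector_def)

text \<open>The mean of l and 2 H - l is H for every l, so the first condition on k is common to the
  whole antidiagonal and the powers of y can be summed as a geometric series.\<close>

lemma sector_antidiagonal:
  assumes "l \<le> 2 * H"
  shows "sector (2 * H) l (2 * H - l) y k =
    (if int (2 * H) dvd k - int H then y powi (int H - int l) else 0)
  - (if int (2 * H) dvd k + int l - int H then y ^ H else 0)"
proof -
  have a: "(int l + int (2 * H - l)) div 2 = int H"
    using assms by simp
  have "int l - int (2 * H - l) = 2 * (int l - int H)"
    using assms by simp
  then have b: "(int l - int (2 * H - l)) div 2 = int l - int H"
    by (metis nonzero_mult_div_cancel_left zero_neq_numeral)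
  show ?thesis
    unfolding sector_def a b by (simp add: algebra_simps)
qed

text \<open>If h does not divide k, exactly one index i is congruent to k and contributes 1. If it
  does, none is, and minus the sum of the powers y^1, ..., y^(h-1) remains, which is 1 or
  -(h-1).\<close>

lemma twist_identity_A:
  assumes y: "y ^ h = 1" and h: "1 < h"
  shows "twist_weight h 1 y k =
    (\<Sum>l\<in>{1..h-1}. \<Sum>l'\<in>{1..h-1}. of_int (ade_N (TypeA (h - 1)) l l') * sector h l l' y k)"
proof -
  have N: "ade_N (TypeA (h - 1)) l l' = (\<Sum>i=1..h-1. abs2 (chi [i]) l l')" for l l'
    using h by simp
  have "(\<Sum>l\<in>{1..h-1}. \<Sum>l'\<in>{1..h-1}. of_int (ade_N (TypeA (h - 1)) l l') * sector h l l' y k) =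
      (\<Sum>i=1..h-1. \<Sum>l\<in>{1..h-1}. \<Sum>l'\<in>{1..h-1}. of_int (abs2 (chi [i]) l l') * sector h l l' y k)"
    unfolding N sum_of_int_sum ..
  also have "\<dots> = (\<Sum>i=1..h-1. sector h i i y k)"
  proof (rule sum.cong)
    fix i assume "i \<in> {1..h-1}"
    then have "set [i] \<subseteq> {1..h-1}" by simp
    from sum_abs2[OF finite_atLeastAtMost this this]
    show "(\<Sum>l\<in>{1..h-1}. \<Sum>l'\<in>{1..h-1}. of_int (abs2 (chi [i]) l l') * sector h l l' y k) =
        sector h i i y k"
      by simp
  qed simp
  also have "\<dots> = (\<Sum>i=1..h-1. if int h dvd k - int i then 1 else 0) -
      (if int h dvd k then \<Sum>i=1..h-1. y ^ i else 0)"
    by (simp add: sector_diagonal sum_subtractf)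
  also have "(\<Sum>i=1..h-1. if int h dvd k - int i then 1 else 0) = (if int h dvd k then 0 else 1 :: complex)"
  proof -
    obtain n where n: "k mod int h = int n" "n \<in> {..<h}"
      using nat_mod_cases[of h k] h by auto
    have "int h dvd k - int i \<longleftrightarrow> i = n" if "i \<in> {1..h-1}" for i
      using that n(1) h by (auto simp: dvd_diff_iff_mod)
    then have "(\<Sum>i=1..h-1. if int h dvd k - int i then 1 else 0) =
        (\<Sum>i=1..h-1. if i = n then 1 else 0 :: complex)"
      by (intro sum.cong) auto
    also have "\<dots> = (if n = 0 then 0 else 1)"
      using n(2) by auto
    also have "n = 0 \<longleftrightarrow> int h dvd k"
      using n(1) by (auto simp: dvd_eq_mod_eq_0)
    finally show ?thesis by simp
  qed
  also have "(\<Sum>i=1..h-1. y ^ i) = (if y = 1 then of_nat (h - 1) else -1)"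
  proof -
    have "{..<h} = insert 0 {1..h-1}"
      using h by auto
    then have "(\<Sum>s<h. y ^ (1 * s)) = 1 + (\<Sum>i=1..h-1. y ^ i)"
      by simp
    moreover have "(\<Sum>s<h. y ^ (1 * s)) = (if y ^ 1 = 1 then of_nat h else 0)"
      by (rule geometric_sum_root_of_unity) (simp add: y)
    ultimately have "1 + (\<Sum>i=1..h-1. y ^ i) = (if y = 1 then of_nat h else 0)"
      by simp
    then have "(\<Sum>i=1..h-1. y ^ i) = (if y = 1 then of_nat h else 0) - 1"
      by (simp only: eq_diff_eq add.commute)
    then show ?thesis
      using h by (simp add: of_nat_diff)
  qed
  finally show ?thesis
    by (auto simp: twist_weight_def)
qed

section \<open>Sums over residues of one parity, for type D\<close>

lemma sum_reflect:
  fixes u :: "nat \<Rightarrow> 'a::comm_monoid_add"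
  shows "(\<Sum>i=1..2*m+1. u i) = (\<Sum>i=1..m. u i + u (2*m+2 - i)) + u (m+1)"
proof -
  have "{1..2*m+1} = ({1..m} \<union> {m+2..2*m+1}) \<union> {m+1}"
    by auto
  also have "sum u \<dots> = sum u ({1..m} \<union> {m+2..2*m+1}) + u (m+1)"
    by (subst sum.union_disjoint) auto
  also have "sum u ({1..m} \<union> {m+2..2*m+1}) = sum u {1..m} + sum u {m+2..2*m+1}"
    by (rule sum.union_disjoint) auto
  also have "sum u {m+2..2*m+1} = (\<Sum>i=1..m. u (2*m+2 - i))"
    by (rule sum.reindex_bij_witness[of _ "\<lambda>i. 2*m+2 - i" "\<lambda>i. 2*m+2 - i"]) auto
  finally show ?thesis
    by (simp add: sum.distrib)
qed

text \<open>For even c the numbers c + 2 i, 1 <= i <= H, run through each even residue modulo 2 H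
  once.\<close>

lemma sum_dvd_unique:
  fixes z :: "'a::comm_monoid_add"
  assumes "H > 0"
  shows "(\<Sum>i=1..H. if int (2 * H) dvd c + 2 * int i then z else 0) = (if even c then z else 0)"
proof (cases "even c")
  case False
  have "\<not> int (2 * H) dvd c + 2 * int i" for i
  proof
    assume "int (2 * H) dvd c + 2 * int i"
    then have "2 dvd c + 2 * int i"
      by (rule dvd_trans[rotated]) simp
    with False show False by simp
  qed
  with False show ?thesis by simp
next
  case True
  then obtain c' where c: "c = 2 * c'" by (elim evenE)
  \<comment> \<open>The solution is i = n + 1: residues start at 0, the summation at 1.\<close>
  obtain n where n: "(- c' - 1) mod int H = int n" "n \<in> {..<H}"
    using nat_mod_cases[of H "- c' - 1"] assms by auto
  have "int (2 * H) dvd c + 2 * int i \<longleftrightarrow> i = n + 1" if "i \<in> {1..H}" for i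
  proof -
    have "c + 2 * int i = 2 * (int i - 1 - (- c' - 1))"
      by (simp add: c)
    then have "int (2 * H) dvd c + 2 * int i \<longleftrightarrow> int H dvd int i - 1 - (- c' - 1)"
      by (metis dvd_mult_cancel_left int_ops(7) of_nat_numeral zero_neq_numeral)
    also have "\<dots> \<longleftrightarrow> (int i - 1) mod int H = int n"
      unfolding dvd_diff_iff_mod n(1) ..
    also have "(int i - 1) mod int H = int i - 1"
      using that by (intro mod_pos_pos_trivial) auto
    finally show ?thesis by auto
  qed
  then have "(\<Sum>i=1..H. if int (2 * H) dvd c + 2 * int i then z else 0) =
      (\<Sum>i=1..H. if i = n + 1 then z else 0)"
    by (intro sum.cong) auto
  with n(2) True show ?thesis by auto
qed

lemma sum_powi_root_of_unity:
  fixes y :: complex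
  assumes "y ^ (2 * H) = 1" "H > 0"
  shows "(\<Sum>i=1..H. y powi (c + 2 * int i)) = (if y\<^sup>2 = 1 then of_nat H * y powi c else 0)"
proof -
  have "y \<noteq> 0" using assms by (metis power_0_left nat_0_less_mult_iff neq0_conv zero_less_numeral zero_neq_one)
  have "(\<Sum>i=1..H. y powi (c + 2 * int i)) = (\<Sum>i=1..H. y powi c * y ^ (2 * i))"
    using \<open>y \<noteq> 0\<close> by (intro sum.cong) (auto simp: power_int_add simp flip: power_int_of_nat)
  also have "\<dots> = (\<Sum>i<H. y powi c * y ^ (2 * Suc i))"
    by (rule sum.reindex_bij_witness[of _ Suc "\<lambda>i. i - 1"]) auto
  also have "\<dots> = y powi c * y\<^sup>2 * (\<Sum>i<H. y ^ (2 * i))"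
    by (simp add: sum_distrib_left power_add power2_eq_square mult_ac)
  also have "(\<Sum>i<H. y ^ (2 * i)) = (if y\<^sup>2 = 1 then of_nat H else 0)"
    by (rule geometric_sum_root_of_unity[OF assms(1)])
  finally show ?thesis by simp
qed

lemma sum_sector_odd_diagonal:
  assumes y: "y ^ (2 * H) = 1" and "H > 0"
  shows "(\<Sum>i=1..H. sector (2 * H) (2 * i - 1) (2 * i - 1) y k) =
    (if odd k then 1 else 0) - (if int (2 * H) dvd k \<and> y\<^sup>2 = 1 then of_nat H * y else 0)"
proof -
  have "(\<Sum>i=1..H. sector (2 * H) (2 * i - 1) (2 * i - 1) y k) =
      (\<Sum>i=1..H. (if int (2 * H) dvd - (k + 1) + 2 * int i then 1 else 0) -
        (if int (2 * H) dvd k then y powi (-1 + 2 * int i) else 0))"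
  proof (rule sum.cong)
    fix i assume "i \<in> {1..H}"
    then have i: "int (2 * i - 1) = -1 + 2 * int i" by auto
    have "int (2 * H) dvd k - int (2 * i - 1) \<longleftrightarrow> int (2 * H) dvd - (k - int (2 * i - 1))"
      by (rule dvd_minus_iff[symmetric])
    also have "- (k - int (2 * i - 1)) = - (k + 1) + 2 * int i"
      unfolding i by simp
    finally show "sector (2 * H) (2 * i - 1) (2 * i - 1) y k =
        (if int (2 * H) dvd - (k + 1) + 2 * int i then 1 else 0) -
        (if int (2 * H) dvd k then y powi (-1 + 2 * int i) else 0)"
      unfolding sector_diagonal i by simp
  qed simp
  also have "\<dots> = (if even (- (k + 1)) then 1 else 0) -
      (if int (2 * H) dvd k then (if y\<^sup>2 = 1 then of_nat H * y powi (-1) else 0) else 0)"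
    unfolding sum_subtractf sum_dvd_unique[OF \<open>H > 0\<close>]
    using sum_powi_root_of_unity[OF y \<open>H > 0\<close>, of "-1"] by simp
  \<comment> \<open>Under the condition y^2 = 1, the inverse of y is y.\<close>
  also have "\<dots> = (if odd k then 1 else 0) - (if int (2 * H) dvd k \<and> y\<^sup>2 = 1 then of_nat H * y else 0)"
    by (auto simp: power2_eq_1_iff)
  finally show ?thesis .
qed

text \<open>With c of the parity of H, l = 2 i - c runs over indices congruent to H modulo 2, so H -
  l is even and only powers of y^2 occur.\<close>

lemma sum_antidiagonal_terms:
  fixes y :: complex
  assumes y: "y ^ (2 * H) = 1" and "H > 0" and "even (c - int H)"
  shows "(\<Sum>i=1..H. (if int (2 * H) dvd k - int H then y powi (int H - (2 * int i - c)) else 0) -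
      (if int (2 * H) dvd k + (2 * int i - c) - int H then y ^ H else 0)) =
    (if int (2 * H) dvd k - int H \<and> y\<^sup>2 = 1 then of_nat H else 0) - (if even k then y ^ H else 0)"
proof -
  have y0: "y \<noteq> 0"
    using assms by (metis power_0_left nat_0_less_mult_iff neq0_conv zero_less_numeral zero_neq_one)
  \<comment> \<open>The exponents decrease in i; passing to the inverse of y makes them increase, as
    \<open>sum_powi_root_of_unity\<close> expects.\<close>
  have "y powi (int H - (2 * int i - c)) = inverse y powi (- (int H + c) + 2 * int i)" for i
    by (simp add: power_int_inverse algebra_simps flip: power_int_minus)
  then have "(\<Sum>i=1..H. y powi (int H - (2 * int i - c))) =
      (if (inverse y)\<^sup>2 = 1 then of_nat H * inverse y powi (- (int H + c)) else 0)"
    using sum_powi_root_of_unity[of "inverse y" H "- (int H + c)"] y \<open>H > 0\<close>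
    by (simp add: power_inverse)
  also have "\<dots> = (if y\<^sup>2 = 1 then of_nat H else 0)"
  proof -
    have "even (- (int H + c))" using assms(3) by simp
    then obtain j where "- (int H + c) = 2 * j" by (elim evenE)
    then have "inverse y powi (- (int H + c)) = ((inverse y)\<^sup>2) powi j"
      by (simp add: power_int_power)
    then show ?thesis by (simp add: power_inverse)
  qed
  finally have 1: "(\<Sum>i=1..H. y powi (int H - (2 * int i - c))) = (if y\<^sup>2 = 1 then of_nat H else 0)" .
  have "k + (2 * int i - c) - int H = (k - c - int H) + 2 * int i" for i
    by simp
  then have 2: "(\<Sum>i=1..H. if int (2 * H) dvd k + (2 * int i - c) - int H then y ^ H else 0) =
      (if even (k - c - int H) then y ^ H else 0)"
    by (simp only: sum_dvd_unique[OF \<open>H > 0\<close>])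
  have 3: "even (k - c - int H) \<longleftrightarrow> even k"
    using assms(3) by auto
  show ?thesis
    unfolding sum_subtractf 2 3 using 1 by (cases "int (2 * H) dvd k - int H") simp_all
qed

text \<open>The two tables for type D have a common shape: the diagonal over all odd l, plus the
  antidiagonal pairs (l, 2 H - l) over l congruent to H modulo 2. The tables list each reflected
  pair once and the fixed index H apart; \<open>sum_reflect\<close> undoes this folding.\<close>

lemma sum_ade_N_D:
  assumes y: "y ^ (2 * H) = 1" and H: "H \<ge> 2"
  shows "(\<Sum>l\<in>{1..2*H-1}. \<Sum>l'\<in>{1..2*H-1}.
      of_int (ade_N (TypeD (H + 1)) l l') * sector (2 * H) l l' y k) =
    (if odd k then 1 else - (y ^ H)) - (if int (2 * H) dvd k \<and> y\<^sup>2 = 1 then of_nat H * y else 0)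
    + (if int (2 * H) dvd k - int H \<and> y\<^sup>2 = 1 then of_nat H else 0)"
proof -
  define f where "f l l' = sector (2 * H) l l' y k" for l l'
  let ?A = "{1..2*H-1}"
  have H0: "H > 0" using H by simp
  have pair: "(\<Sum>l\<in>?A. \<Sum>l'\<in>?A. of_int (sesq (chi is) (chi js) l l') * f l l') = (\<Sum>i\<leftarrow>is. \<Sum>j\<leftarrow>js. f i j)"
    if "set is \<subseteq> ?A" "set js \<subseteq> ?A" for "is" js
    using that by (intro sum_sesq) auto
  have "(\<Sum>l\<in>?A. \<Sum>l'\<in>?A. of_int (ade_N (TypeD (H + 1)) l l') * f l l') =
    (\<Sum>i=1..H. f (2 * i - 1) (2 * i - 1)) +
    (\<Sum>i=1..H. (if int (2 * H) dvd k - int H then y powi (int H - (2 * int i - of_bool (odd H))) else 0) -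
      (if int (2 * H) dvd k + (2 * int i - of_bool (odd H)) - int H then y ^ H else 0))"
  proof (cases "odd H")
    case True
    then obtain m where m: "H = 2 * m + 1" by (elim oddE)
    define u where "u i = f (2 * i - 1) (2 * i - 1) + f (2 * i - 1) (2 * H - (2 * i - 1))" for i
    have "(\<Sum>l\<in>?A. \<Sum>l'\<in>?A. of_int (ade_N (TypeD (H + 1)) l l') * f l l') =
        (\<Sum>i=1..m. \<Sum>l\<in>?A. \<Sum>l'\<in>?A. of_int (abs2 (chi [2*i - 1, 2*H - (2*i - 1)]) l l') * f l l') +
        2 * (\<Sum>l\<in>?A. \<Sum>l'\<in>?A. of_int (abs2 (chi [H]) l l') * f l l')"
    proof -
      have N: "ade_N (TypeD (H + 1)) l l' =
          (\<Sum>i=1..m. abs2 (chi [2*i - 1, 2*H - (2*i - 1)]) l l') + 2 * abs2 (chi [H]) l l'" for l l'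
      proof -
        have "(2 * H - 2) div 4 = m" using m by simp
        with True show ?thesis by (simp add: Let_def)
      qed
      show ?thesis
        unfolding N of_int_add distrib_right sum.distrib sum_of_int_sum
        by (simp add: sum_distrib_left mult.assoc)
    qed
    also have "(\<Sum>l\<in>?A. \<Sum>l'\<in>?A. of_int (abs2 (chi [H]) l l') * f l l') = f H H"
      unfolding abs2_def using H by (subst pair) auto
    also have "(\<Sum>i=1..m. \<Sum>l\<in>?A. \<Sum>l'\<in>?A. of_int (abs2 (chi [2*i - 1, 2*H - (2*i - 1)]) l l') * f l l') =
        (\<Sum>i=1..m. u i + u (2 * m + 2 - i))"
    proof (rule sum.cong)
      fix i assume i: "i \<in> {1..m}"
      have e: "2 * (2 * m + 2 - i) - 1 = 2 * H - (2 * i - 1)" "2 * H - (2 * H - (2 * i - 1)) = 2 * i - 1"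
        using i m by auto
      have "set [2*i - 1, 2*H - (2*i - 1)] \<subseteq> ?A"
        using i m by auto
      from pair[OF this this]
      show "(\<Sum>l\<in>?A. \<Sum>l'\<in>?A. of_int (abs2 (chi [2*i - 1, 2*H - (2*i - 1)]) l l') * f l l') =
          u i + u (2 * m + 2 - i)"
        unfolding abs2_def u_def e by simp
    qed simp
    \<comment> \<open>The coefficient 2 in the table: at the fixed index H the diagonal and the
      antidiagonal term coincide.\<close>
    also have "2 * f H H = u (m + 1)"
      by (simp add: u_def m)
    also have "(\<Sum>i=1..m. u i + u (2 * m + 2 - i)) + u (m + 1) = (\<Sum>i=1..H. u i)"
      unfolding m by (rule sum_reflect[symmetric])
    also have "\<dots> = (\<Sum>i=1..H. f (2 * i - 1) (2 * i - 1)) + (\<Sum>i=1..H. f (2 * i - 1) (2 * H - (2 * i - 1)))"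
      unfolding u_def by (rule sum.distrib)
    also have "(\<Sum>i=1..H. f (2 * i - 1) (2 * H - (2 * i - 1))) =
        (\<Sum>i=1..H. (if int (2 * H) dvd k - int H then y powi (int H - (2 * int i - of_bool (odd H))) else 0) -
        (if int (2 * H) dvd k + (2 * int i - of_bool (odd H)) - int H then y ^ H else 0))"
    proof (rule sum.cong)
      fix i assume i: "i \<in> {1..H}"
      then have e: "int (2 * i - 1) = 2 * int i - of_bool (odd H)"
        using True by auto
      have "2 * i - 1 \<le> 2 * H" using i by auto
      from sector_antidiagonal[OF this, of y k]
      show "f (2 * i - 1) (2 * H - (2 * i - 1)) =
          (if int (2 * H) dvd k - int H then y powi (int H - (2 * int i - of_bool (odd H))) else 0) -
          (if int (2 * H) dvd k + (2 * int i - of_bool (odd H)) - int H then y ^ H else 0)"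
        unfolding f_def e .
    qed simp
    finally show ?thesis .
  next
    case False
    then obtain m where m: "H = 2 * m" by blast
    then have m1: "2 * (m - 1) + 1 = H - 1" "m \<ge> 1" using H by auto
    define u where "u i = f (2 * i) (2 * H - 2 * i)" for i
    define v where "v i = (if int (2 * H) dvd k - int H then y powi (int H - 2 * int i) else 0) -
        (if int (2 * H) dvd k + 2 * int i - int H then y ^ H else 0)" for i
    have "(\<Sum>l\<in>?A. \<Sum>l'\<in>?A. of_int (ade_N (TypeD (H + 1)) l l') * f l l') =
        (\<Sum>i=1..H. \<Sum>l\<in>?A. \<Sum>l'\<in>?A. of_int (abs2 (chi [2*i - 1]) l l') * f l l') +
        (\<Sum>l\<in>?A. \<Sum>l'\<in>?A. of_int (abs2 (chi [H]) l l') * f l l') +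
        (\<Sum>i=1..m-1. (\<Sum>l\<in>?A. \<Sum>l'\<in>?A. of_int (sesq (chi [2*i]) (chi [2*H - 2*i]) l l') * f l l') +
          (\<Sum>l\<in>?A. \<Sum>l'\<in>?A. of_int (sesq (chi [2*H - 2*i]) (chi [2*i]) l l') * f l l'))"
    proof -
      have N: "ade_N (TypeD (H + 1)) l l' =
          (\<Sum>i=1..H. abs2 (chi [2*i - 1]) l l') + abs2 (chi [H]) l l' +
          (\<Sum>i=1..m-1. sesq (chi [2*i]) (chi [2*H - 2*i]) l l' + sesq (chi [2*H - 2*i]) (chi [2*i]) l l')"
        for l l'
      proof -
        have "2 * H div 4 = m" using m by simp
        with False show ?thesis by (simp add: Let_def)
      qed
      show ?thesis
        unfolding N of_int_add distrib_right sum.distrib sum_of_int_sum ..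
    qed
    also have "(\<Sum>l\<in>?A. \<Sum>l'\<in>?A. of_int (abs2 (chi [H]) l l') * f l l') = u m"
      unfolding abs2_def using H by (subst pair) (auto simp: u_def m)
    also have "(\<Sum>i=1..H. \<Sum>l\<in>?A. \<Sum>l'\<in>?A. of_int (abs2 (chi [2*i - 1]) l l') * f l l') =
        (\<Sum>i=1..H. f (2 * i - 1) (2 * i - 1))"
    proof (rule sum.cong)
      fix i assume "i \<in> {1..H}"
      then have "set [2*i - 1] \<subseteq> ?A" by auto
      from pair[OF this this]
      show "(\<Sum>l\<in>?A. \<Sum>l'\<in>?A. of_int (abs2 (chi [2*i - 1]) l l') * f l l') = f (2 * i - 1) (2 * i - 1)"
        unfolding abs2_def by simp
    qed simp
    also have "(\<Sum>i=1..m-1. (\<Sum>l\<in>?A. \<Sum>l'\<in>?A. of_int (sesq (chi [2*i]) (chi [2*H - 2*i]) l l') * f l l') +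
          (\<Sum>l\<in>?A. \<Sum>l'\<in>?A. of_int (sesq (chi [2*H - 2*i]) (chi [2*i]) l l') * f l l')) =
        (\<Sum>i=1..m-1. u i + u (2 * (m - 1) + 2 - i))"
    proof (rule sum.cong)
      fix i assume i: "i \<in> {1..m-1}"
      have e: "2 * (2 * (m - 1) + 2 - i) = 2 * H - 2 * i" "2 * H - (2 * H - 2 * i) = 2 * i"
        using i m by auto
      have s: "set [2*i] \<subseteq> ?A" "set [2*H - 2*i] \<subseteq> ?A"
        using i m by auto
      show "(\<Sum>l\<in>?A. \<Sum>l'\<in>?A. of_int (sesq (chi [2*i]) (chi [2*H - 2*i]) l l') * f l l') +
          (\<Sum>l\<in>?A. \<Sum>l'\<in>?A. of_int (sesq (chi [2*H - 2*i]) (chi [2*i]) l l') * f l l') =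
          u i + u (2 * (m - 1) + 2 - i)"
        unfolding pair[OF s] pair[OF s(2,1)] u_def e by simp
    qed simp
    also have "(\<Sum>i=1..H. f (2 * i - 1) (2 * i - 1)) + u m +
        (\<Sum>i=1..m-1. u i + u (2 * (m - 1) + 2 - i)) =
        (\<Sum>i=1..H. f (2 * i - 1) (2 * i - 1)) + (\<Sum>i=1..H-1. u i)"
    proof -
      have "(\<Sum>i=1..H-1. u i) = (\<Sum>i=1..m-1. u i + u (2 * (m - 1) + 2 - i)) + u m"
        using sum_reflect[of u "m - 1"] unfolding m1(1) le_add_diff_inverse2[OF m1(2)] .
      then show ?thesis by (simp only: add_ac)
    qed
    also have "(\<Sum>i=1..H-1. u i) = (\<Sum>i=1..H-1. v i)"
    proof (rule sum.cong)
      fix i assume "i \<in> {1..H-1}"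
      then have "2 * i \<le> 2 * H" by auto
      from sector_antidiagonal[OF this, of y k] show "u i = v i"
        by (simp add: u_def v_def f_def)
    qed simp
    also have "\<dots> = (\<Sum>i=1..H. v i)"
    \<comment> \<open>The index l = 2 H is added to complete the residues: its two terms cancel,
      since y^(-H) = y^H and the two conditions on k agree modulo 2 H.\<close>
    proof -
      have "y ^ H * y ^ H = 1"
        using y by (simp add: mult_2 power_add)
      then have "y powi (- int H) = y ^ H"
        by (simp add: power_int_minus inverse_unique)
      moreover have "int (2 * H) dvd (k - int H) + 1 * int (2 * H) \<longleftrightarrow> int (2 * H) dvd k - int H"
        by (rule dvd_add_times_triv_right_iff)
      ultimately have "v H = 0"
        by (simp add: v_def algebra_simps)
      moreover have "{1..H} = insert H {1..H-1}" "H \<notin> {1..H-1}"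
        using H0 by auto
      ultimately show ?thesis by simp
    qed
    finally have "(\<Sum>l\<in>?A. \<Sum>l'\<in>?A. of_int (ade_N (TypeD (H + 1)) l l') * f l l') =
        (\<Sum>i=1..H. f (2 * i - 1) (2 * i - 1)) + (\<Sum>i=1..H. v i)" .
    moreover have "of_bool (odd H) = (0 :: int)"
      using False by simp
    ultimately show ?thesis
      unfolding v_def by (simp only: diff_zero)
  qed
  moreover have "even (of_bool (odd H) - int H)"
    by (cases "odd H") auto
  ultimately show ?thesis
    using sum_sector_odd_diagonal[OF y H0, of k]
      sum_antidiagonal_terms[OF y H0 \<open>even (of_bool (odd H) - int H)\<close>, of k]
    unfolding f_def by (auto split: if_splits)
qed

text \<open>Unless y^2 = 1 and H divides k, the degrees 2 and H - 1 have weight 1 and only that of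
  degree H matters. Otherwise y is 1 or -1 and k = H j, and the claim depends only on y and the
  parities of H and j.\<close>

lemma twist_identity_D:
  assumes y: "y ^ (2 * H) = 1" and H: "H \<ge> 3"
  shows "twist_weight (2 * H) 2 y k * twist_weight (2 * H) (H - 1) y k * twist_weight (2 * H) H y k =
    (\<Sum>l\<in>{1..2*H-1}. \<Sum>l'\<in>{1..2*H-1}.
      of_int (ade_N (TypeD (H + 1)) l l') * sector (2 * H) l l' y k)"
proof -
  have H_dvd: "int H dvd int (2 * H)" by simp
  have "int (2 * H) dvd k * int H \<longleftrightarrow> 2 * int H dvd k * int H"
    "int (2 * H) dvd k * int 2 \<longleftrightarrow> int H * 2 dvd k * 2"
    by (simp_all add: mult.commute)
  then have hdvd: "int (2 * H) dvd k * int H \<longleftrightarrow> even k" "int (2 * H) dvd k * int 2 \<longleftrightarrow> int H dvd k"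
    using H unfolding dvd_mult_cancel_right by simp_all
  have "(y ^ H)\<^sup>2 = 1"
    using y by (simp add: power_mult[symmetric] mult.commute)
  then have yH: "y ^ H = 1 \<or> y ^ H = -1"
    by (simp add: power2_eq_1_iff)
  have w3: "twist_weight (2 * H) H y k = (if odd k then 1 else - (y ^ H))"
    using yH H hdvd(1) by (auto simp: twist_weight_def)
  have w2: "twist_weight (2 * H) 2 y k = (if y\<^sup>2 = 1 \<and> int H dvd k then - of_nat (H - 1) else 1)"
  proof -
    have "2 * H - 2 = 2 * (H - 1)" by simp
    then have "- of_nat (2 * H - 2) / of_nat 2 = (- of_nat (H - 1) :: complex)"
      by (simp only: of_nat_mult) simp
    then show ?thesis
      unfolding twist_weight_def hdvd(2) by simp
  qed
  show ?thesis
  proof (cases "y\<^sup>2 = 1 \<and> int H dvd k")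
    case False
    \<comment> \<open>A nontrivial weight of degree H - 1 forces one of degree 2: 2 H = 2 (H - 1) +
      2 gives y^2 = 1, and coprimality of H and H - 1 gives that H divides k.\<close>
    have "\<not> (y ^ (H - 1) = 1 \<and> int (2 * H) dvd k * int (H - 1))"
    proof
      assume *: "y ^ (H - 1) = 1 \<and> int (2 * H) dvd k * int (H - 1)"
      have "2 * H = (H - 1) * 2 + 2" using H by simp
      then have "y ^ (2 * H) = (y ^ (H - 1))\<^sup>2 * y\<^sup>2"
        by (simp only: power_add power_mult)
      then have "y\<^sup>2 = 1"
        using * y by simp
      moreover have "int H dvd k"
      proof -
        have "int H dvd k * int (H - 1)"
          using dvd_trans[OF H_dvd conjunct2[OF *]] .
        moreover have "coprime (int H) (int (H - 1))"
          using coprime_diff_one_right_nat[of H] H by simp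
        ultimately show ?thesis
          by (simp add: coprime_dvd_mult_left_iff)
      qed
      ultimately show False using False by simp
    qed
    then have w1: "twist_weight (2 * H) (H - 1) y k = 1"
      unfolding twist_weight_def by (rule if_not_P)
    have "int H dvd k" if "int (2 * H) dvd k"
      using dvd_trans[OF H_dvd that] .
    moreover have "int H dvd k" if "int (2 * H) dvd k - int H"
      using dvd_add[OF dvd_trans[OF H_dvd that] dvd_refl[of "int H"]] by (simp only: diff_add_cancel)
    ultimately show ?thesis
      using sum_ade_N_D[OF y, of k] H False unfolding w1 w2 w3 by auto
  next
    case True
    then obtain j where j: "k = int H * j" by (elim conjE dvdE)
    have y1: "y = 1 \<or> y = -1"
      using True by (simp add: power2_eq_1_iff)
    have two_H: "int (2 * H) dvd n * int H \<longleftrightarrow> even n" for n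
    proof -
      have "int (2 * H) dvd n * int H \<longleftrightarrow> 2 * int H dvd n * int H"
        by simp
      then show ?thesis
        using H unfolding dvd_mult_cancel_right by simp
    qed
    have hk: "int (2 * H) dvd k \<longleftrightarrow> even j"
      using two_H[of j] by (simp only: j mult.commute[of j])
    have hkH: "int (2 * H) dvd k - int H \<longleftrightarrow> odd j"
    proof -
      have "k - int H = (j - 1) * int H"
        by (simp add: j algebra_simps)
      then show ?thesis
        using two_H[of "j - 1"] by simp
    qed
    have "int (2 * H) dvd k * int (H - 1) \<longleftrightarrow> even (j * int (H - 1))"
    proof -
      have "k * int (H - 1) = (j * int (H - 1)) * int H"
        unfolding j by (simp only: mult_ac)
      then show ?thesis
        using two_H[of "j * int (H - 1)"] by (simp only:)
    qed
    moreover have "(- of_nat (2 * H - (H - 1)) / of_nat (H - 1) :: complex) =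
        - (of_nat H + 1) / of_nat (H - 1)"
    proof -
      have "2 * H - (H - 1) = H + 1" using H by simp
      then show ?thesis by simp
    qed
    ultimately have w1: "twist_weight (2 * H) (H - 1) y k =
        (if y ^ (H - 1) = 1 \<and> even (j * int (H - 1)) then - (of_nat H + 1) / of_nat (H - 1) else 1)"
      unfolding twist_weight_def by simp
    have H1: "of_nat (H - 1) \<noteq> (0::complex)" "of_nat (H - 1) = (of_nat H - 1 :: complex)"
      using H by (simp_all add: of_nat_diff)
    have yH1: "y ^ (H - 1) = (if odd H then 1 else y)" and yH': "y ^ H = (if odd H then y else 1)"
      using y1 H by auto
    \<comment> \<open>The first weight is -(H - 1) throughout this case; it clears the denominator
      of the second and leaves H + 1 when both are nontrivial.\<close>
    have w12: "twist_weight (2 * H) 2 y k * twist_weight (2 * H) (H - 1) y k =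
        (if odd H \<or> y = 1 \<and> even j then of_nat H + 1 else 1 - of_nat H)"
    proof -
      have "even (j * int (H - 1)) \<longleftrightarrow> odd H \<or> even j"
        using H by auto
      then have "y ^ (H - 1) = 1 \<and> even (j * int (H - 1)) \<longleftrightarrow> odd H \<or> y = 1 \<and> even j"
        unfolding yH1 by auto
      moreover have "- c * (- x / c) = x" if "c \<noteq> 0" for c x :: complex
        using that by simp
      from this[OF H1(1)] have "- of_nat (H - 1) * (- (of_nat H + 1) / of_nat (H - 1)) =
          (of_nat H + 1 :: complex)" .
      moreover have "- of_nat (H - 1) * 1 = (1 - of_nat H :: complex)"
        unfolding H1(2) by simp
      ultimately show ?thesis
        unfolding w1 w2 using True by presburger
    qed
    have odd_k: "odd k \<longleftrightarrow> odd H \<and> odd j"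
      by (simp add: j)
    have "(if odd H \<or> y = 1 \<and> even j then of_nat H + 1 else 1 - of_nat H) *
        (if odd H \<and> odd j then 1 else - (if odd H then y else 1)) =
        (if odd H \<and> odd j then 1 else - (if odd H then y else 1)) -
        (if even j then of_nat H * y else 0) + (if odd j then of_nat H else 0)"
      using y1 by (cases "odd H"; cases "odd j") (auto simp: algebra_simps)
    moreover have "2 \<le> H" using H by simp
    ultimately show ?thesis
      unfolding w12 w3 sum_ade_N_D[OF y \<open>2 \<le> H\<close>] hk hkH odd_k yH' using True by simp
  qed
qed

theorem theorem9p35:
  fixes T :: ade and q :: complex
  assumes "is_ade T"
    and "0 < norm q" and "norm q < 1"
  shows "mero_eq_on (- {0})
           (\<lambda>x. \<Prod>d\<leftarrow>ade_d T. theta_factor (coxeter T) d x q)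
           (\<lambda>x. \<Sum>(l, l') \<in> {(l, l'). l \<in> {1..coxeter T - 1} \<and> l' \<in> {1..coxeter T - 1}
                                    \<and> ade_N T l l' \<noteq> 0}.
                  of_int (ade_N T l l') * JJ (coxeter T) l l' x q)"
proof -
  define h where "h = coxeter T"
  have h: "h > 1"
    using assms(1) by (cases T) (auto simp: h_def)
  \<comment> \<open>Any h-th root of q would do; another choice multiplies \<open>p\<close> by a
    root of unity, which y absorbs.\<close>
  define p where "p = exp (Ln q / of_nat h)"
  have "p ^ h = q"
    using assms(2) h by (simp add: p_def flip: exp_of_nat_mult)
  then interpret nome_root q h p
    using assms(2,3) h by unfold_locales auto
  define S where "S = {(l, l'). l \<in> {1..h - 1} \<and> l' \<in> {1..h - 1} \<and> ade_N T l l' \<noteq> 0}"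
  have terms: "JJ_term q h p l l'" if "(l, l') \<in> S" for l l'
  proof
    show "0 < l" "l < h" "0 < l'"
      using that by (auto simp: S_def)
    have "ade_N T l l' \<noteq> 0"
      using that by (simp add: S_def)
    from ade_N_nonzeroD[OF this]
    show "even (int l - int l')" "4 * int h dvd (int l)\<^sup>2 - (int l')\<^sup>2"
      by (simp_all only: h_def)
  qed
  have S_sum: "(\<Sum>(l, l')\<in>S. of_int (ade_N T l l') * sector h l l' y k) =
      (\<Sum>l\<in>{1..h-1}. \<Sum>l'\<in>{1..h-1}. of_int (ade_N T l l') * sector h l l' y k)" for y k
    unfolding S_def by (rule sum_nonzero_coefficients) simp
  have "mero_eq_on (- {0}) (\<lambda>x. \<Prod>d\<leftarrow>ade_d T. theta_factor h d x q)
      (\<lambda>x. \<Sum>(l, l')\<in>S. of_int (ade_N T l l') * JJ h l l' x q)"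
  proof (cases T)
    case (TypeA n)
    then have n: "n = h - 1" by (simp add: h_def)
    have "(\<Prod>d\<leftarrow>ade_d T. theta_factor h d x q) = theta_factor h 1 x q" for x
    proof -
      have "ade_d T = [1, of_nat h / 2, of_nat h / 2]"
        by (simp add: TypeA h_def Let_def)
      moreover have "theta_factor h (of_nat h / 2) x q = 1"
        by (simp add: theta_factor_def)
      ultimately show ?thesis by simp
    qed
    moreover have "mero_eq_on (- {0}) (\<lambda>x. theta_factor h 1 x q)
        (\<lambda>x. \<Sum>(l, l')\<in>S. of_int (ade_N T l l') * JJ h l l' x q)"
    proof (rule mero_eq_on_one_factor[OF terms h])
      show "twist_weight h 1 y k = (\<Sum>(l, l')\<in>S. of_int (ade_N T l l') * sector h l l' y k)"
        if "y ^ h = 1" for y k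
        unfolding S_sum unfolding TypeA n by (rule twist_identity_A[OF that h])
    qed
    ultimately show ?thesis by (simp only:)
  next
    case (TypeD n)
    define H where "H = n - 1"
    have H: "H \<ge> 3" "h = 2 * H" "n = H + 1"
      using assms(1) by (auto simp: TypeD H_def h_def)
    have d: "ade_d T = [of_nat 2, of_nat (H - 1), of_nat H]"
      using H by (simp add: TypeD Let_def of_nat_diff)
    show ?thesis
      unfolding d
    proof (rule mero_eq_on_three_factors[OF terms])
      show "\<exists>L. (\<lambda>x. theta_factor h (of_nat 2) x q * theta_factor h (of_nat (H - 1)) x q) \<midarrow>x\<^sub>0\<rightarrow> L"
        if "x\<^sub>0 \<noteq> 0" "\<And>k. x\<^sub>0 ^ h \<noteq> q powi k" for x\<^sub>0
      proof -
        have "h - 2 = (H - 1) * 2" using H by simp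
        then have "H - 1 dvd h - 2" by simp
        then show ?thesis
          using theta_factor_pair_lim_ex[OF that, of 2 "H - 1"] H by (simp add: mult.commute)
      qed
      show "twist_weight h 2 y k * twist_weight h (H - 1) y k * twist_weight h H y k =
          (\<Sum>(l, l')\<in>S. of_int (ade_N T l l') * sector h l l' y k)" if "y ^ h = 1" for y k
        unfolding S_sum unfolding TypeD H(2,3)
        by (rule twist_identity_D) (use that H in simp_all)
    qed (use H in auto)
  next
    case TypeE6
    then have h_eq: "h = 12" by (simp add: h_def)
    have d: "ade_d T = [of_nat 3, of_nat 4, of_nat 6]"
      by (simp add: TypeE6)
    show ?thesis
      unfolding d
    proof (rule mero_eq_on_three_factors[OF terms])
      show "\<exists>L. (\<lambda>x. theta_factor h (of_nat 3) x q * theta_factor h (of_nat 4) x q) \<midarrow>x\<^sub>0\<rightarrow> L"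
        if "x\<^sub>0 \<noteq> 0" "\<And>k. x\<^sub>0 ^ h \<noteq> q powi k" for x\<^sub>0
        by (rule theta_factor_mult_lim_ex[OF that]) (simp_all add: h_eq)
      show "twist_weight h 3 y k * twist_weight h 4 y k * twist_weight h 6 y k =
          (\<Sum>(l, l')\<in>S. of_int (ade_N T l l') * sector h l l' y k)" if "y ^ h = 1" for y k
      proof -
        have "h - 1 = 11" by (simp add: h_eq)
        then show ?thesis
          using twist_identity_E6 that unfolding S_sum unfolding TypeE6 h_eq by (simp only:)
      qed
    qed (simp_all add: h_eq)
  next
    case TypeE7
    then have h_eq: "h = 18" by (simp add: h_def)
    have d: "ade_d T = [of_nat 4, of_nat 6, of_nat 9]"
      by (simp add: TypeE7)
    show ?thesis
      unfolding d
    proof (rule mero_eq_on_three_factors[OF terms])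
      show "\<exists>L. (\<lambda>x. theta_factor h (of_nat 4) x q * theta_factor h (of_nat 6) x q) \<midarrow>x\<^sub>0\<rightarrow> L"
        if "x\<^sub>0 \<noteq> 0" "\<And>k. x\<^sub>0 ^ h \<noteq> q powi k" for x\<^sub>0
        by (rule theta_factor_pair_lim_ex[OF that]) (simp_all add: h_eq)
      show "twist_weight h 4 y k * twist_weight h 6 y k * twist_weight h 9 y k =
          (\<Sum>(l, l')\<in>S. of_int (ade_N T l l') * sector h l l' y k)" if "y ^ h = 1" for y k
      proof -
        have "h - 1 = 17" by (simp add: h_eq)
        then show ?thesis
          using twist_identity_E7 that unfolding S_sum unfolding TypeE7 h_eq by (simp only:)
      qed
    qed (simp_all add: h_eq)
  next
    case TypeE8
    then have h_eq: "h = 30" by (simp add: h_def)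
    have d: "ade_d T = [of_nat 6, of_nat 10, of_nat 15]"
      by (simp add: TypeE8)
    show ?thesis
      unfolding d
    proof (rule mero_eq_on_three_factors[OF terms])
      show "\<exists>L. (\<lambda>x. theta_factor h (of_nat 6) x q * theta_factor h (of_nat 10) x q) \<midarrow>x\<^sub>0\<rightarrow> L"
        if "x\<^sub>0 \<noteq> 0" "\<And>k. x\<^sub>0 ^ h \<noteq> q powi k" for x\<^sub>0
        by (rule theta_factor_mult_lim_ex[OF that]) (simp_all add: h_eq)
      show "twist_weight h 6 y k * twist_weight h 10 y k * twist_weight h 15 y k =
          (\<Sum>(l, l')\<in>S. of_int (ade_N T l l') * sector h l l' y k)" if "y ^ h = 1" for y k
      proof -
        have "h - 1 = 29" by (simp add: h_eq)
        then show ?thesis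
          using twist_identity_E8 that unfolding S_sum unfolding TypeE8 h_eq by (simp only:)
      qed
    qed (simp_all add: h_eq)
  qed
  then show ?thesis
    unfolding S_def h_def .
qed

end
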